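(* Let $\Delta$ be a $d$-convex union representable simplicial complex, and let $\tau_1,\tau_2\in\Delta$ be such that $\tau_1\cup\tau_2\notin\Delta$. Then there exist simplicial complexes $\Delta_1\subseteq\Delta\setminus\tau_1$ and $\Delta_2\subseteq\Delta\setminus\tau_2$ satisfying: (i) $\Delta=\Delta_1\cup\Delta_2$; (ii) $\Delta$ collapses onto $\Delta_i$ for $i=1,2$; (iii) $\Delta_i$ collapses onto $\Delta_1\cap\Delta_2$ for $i=1,2$; (iv) $\Delta_1$ and $\Delta_2$ are $d$-convex union representable; and (v) $\Delta_1\cap\Delta_2$ is $(d-1)$-convex union representable.
   Context: A simplicial complex on a finite ground set is a collection $\Delta$ of subsets (faces) closed under inclusion; elements of the ground set need not be vertices. The void complex $\emptyset$ (no faces) is allowed and is distinct from the empty complex $\{\emptyset\}$. Facets are inclusion-maximal faces. The deletion is $\Delta\setminus\sigma=\{\tau\in\Delta\mid\tau\not\supseteq\sigma\}$. A face $\sigma$ that is not a facet is free if it is contained in a unique facet; then $\Delta\to\Delta\setminus\sigma$ is an elementary collapse. (The empty face may be used as a free face.) $\Delta$ collapses onto $\Gamma$ if there is a (possibly empty) finite sequence of elementary collapses starting with $\Delta$ and ending with $\Gamma$. For a collection $\mathcal U=\{U_1,\dots,U_n\}$ of convex subsets of $\mathbb R^d$ (the empty set is convex, open and closed), put $U_\sigma=\bigcap_{i\in\sigma}U_i$ for $\emptyset\ne\sigma\subseteq[n]$ and $U_\emptyset=\operatorname{conv}(\bigcup_i U_i)$. The nerve is $\mathcal N(\mathcal U)=\{\sigma\subseteq[n]\mid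 U_\sigma\neq\emptyset\}$ (so it is the void complex if all $U_i$ are empty). A complex $\Delta\subseteq 2^{[n]}$ is $d$-convex union representable ($d\ge 0$ an integer) if $\Delta=\mathcal N(\mathcal U)$ for some collection $\mathcal U=\{U_i\}_{i=1}^n$ of convex open sets in $\mathbb R^d$ whose union is convex. *)

theory Defs
  imports "HOL-Analysis.Analysis" "HOL-Library.Function_Algebras"
begin

text \<open>
  The dimension must be a term, since dimensions \<open>d\<close> and \<open>d - 1\<close> (possibly \<open>0\<close>) occur together.
  So \<open>\<real>\<^sup>d\<close> is the library's \<^const>\<open>Euclidean_space\<close> \<open>d\<close>, carried by the functions
  \<open>x :: nat \<Rightarrow> real\<close> with \<open>x i = 0\<close> for all \<open>i \<ge> d\<close>.  The pointwise vector space structure on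
  functions (addition comes from \<^theory>\<open>HOL-Library.Function_Algebras\<close>) makes the library's
  \<^const>\<open>convex\<close> and convex hull available there.
\<close>

instantiation "fun" :: (type, real_vector) real_vector
begin

definition scaleR_fun :: "real \<Rightarrow> ('a \<Rightarrow> 'b) \<Rightarrow> 'a \<Rightarrow> 'b"
  where "scaleR_fun r f = (\<lambda>x. r *\<^sub>R f x)"

instance
  by standard (auto simp: scaleR_fun_def fun_eq_iff scaleR_add_right scaleR_add_left)

end

lemma scaleR_fun_apply [simp]: "(r *\<^sub>R f) x = r *\<^sub>R f x"
  by (simp add: scaleR_fun_def)

definition abstract_simplicial_complex :: "'v set \<Rightarrow> 'v set set \<Rightarrow> bool"
  where "abstract_simplicial_complex V \<Delta> \<longleftrightarrow>
    finite V \<and> \<Delta> \<subseteq> Pow V \<and> (\<forall>\<sigma>\<in>\<Delta>. \<forall>\<tau>. \<tau> \<subseteq> \<sigma> \<longrightarrow> \<tau> \<in> \<Delta>)"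

definition facet :: "'v set set \<Rightarrow> 'v set \<Rightarrow> bool"
  where "facet \<Delta> F \<longleftrightarrow> F \<in> \<Delta> \<and> (\<forall>\<tau>\<in>\<Delta>. F \<subseteq> \<tau> \<longrightarrow> \<tau> = F)"

definition deletion :: "'v set set \<Rightarrow> 'v set \<Rightarrow> 'v set set"
  where "deletion \<Delta> \<sigma> = {\<tau> \<in> \<Delta>. \<not> \<sigma> \<subseteq> \<tau>}"

text \<open>The empty face is not excluded.\<close>

definition free_face :: "'v set set \<Rightarrow> 'v set \<Rightarrow> bool"
  where "free_face \<Delta> \<sigma> \<longleftrightarrow> \<sigma> \<in> \<Delta> \<and> \<not> facet \<Delta> \<sigma> \<and> (\<exists>!F. facet \<Delta> F \<and> \<sigma> \<subseteq> F)"

definition elementary_collapse :: "'v set set \<Rightarrow> 'v set set \<Rightarrow> bool"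
  where "elementary_collapse \<Delta> \<Gamma> \<longleftrightarrow> (\<exists>\<sigma>. free_face \<Delta> \<sigma> \<and> \<Gamma> = deletion \<Delta> \<sigma>)"

definition collapses_onto :: "'v set set \<Rightarrow> 'v set set \<Rightarrow> bool"
  where "collapses_onto = elementary_collapse\<^sup>*\<^sup>*"

definition face_region :: "'v set \<Rightarrow> ('v \<Rightarrow> (nat \<Rightarrow> real) set) \<Rightarrow> 'v set \<Rightarrow> (nat \<Rightarrow> real) set"
  where "face_region V U \<sigma> =
    (if \<sigma> = {} then convex hull (\<Union>i\<in>V. U i) else (\<Inter>i\<in>\<sigma>. U i))"

definition nerve :: "'v set \<Rightarrow> ('v \<Rightarrow> (nat \<Rightarrow> real) set) \<Rightarrow> 'v set set"
  where "nerve V U = {\<sigma>. \<sigma> \<subseteq> V \<and> face_region V U \<sigma> \<noteq> {}}"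

text \<open>Openness in \<^const>\<open>Euclidean_space\<close> \<open>d\<close> includes that the sets lie in \<open>\<real>\<^sup>d\<close>.\<close>

definition convex_union_representable :: "'v set \<Rightarrow> nat \<Rightarrow> 'v set set \<Rightarrow> bool"
  where "convex_union_representable V d \<Delta> \<longleftrightarrow>
    abstract_simplicial_complex V \<Delta> \<and>
    (\<exists>U. (\<forall>i\<in>V. openin (Euclidean_space d) (U i) \<and> convex (U i)) \<and>
         convex (\<Union>i\<in>V. U i) \<and> \<Delta> = nerve V U)"

lemma abstract_simplicial_complex_nerve:
  assumes "finite V"
  shows "abstract_simplicial_complex V (nerve V U)"
proof -
  have "face_region V U \<tau> \<noteq> {}"
    if "\<sigma> \<subseteq> V" "face_region V U \<sigma> \<noteq> {}" "\<tau> \<subseteq> \<sigma>" for \<sigma> \<tau>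
    using that by (cases "\<sigma> = {}"; cases "\<tau> = {}") (auto simp: face_region_def; blast)+
  with assms show ?thesis
    by (auto simp: abstract_simplicial_complex_def nerve_def)
qed

end

theory Submission
  imports Defs "HOL-Library.Poly_Mapping"
begin

text \<open>
  Write \<open>\<Delta>\<close> as the nerve of convex open sets \<open>U i\<close> in \<open>\<real>\<^sup>d\<close> with convex union.  The intersections
  belonging to \<open>\<tau>\<^sub>1\<close> and \<open>\<tau>\<^sub>2\<close> are disjoint, so a hyperplane \<open>h = b\<close> separates them.  Let \<open>\<Delta>\<^sub>1\<close> and
  \<open>\<Delta>\<^sub>2\<close> be the nerves of the traces of the \<open>U i\<close> on the open half-spaces \<open>h > b\<close> and \<open>h < b\<close>.
  A nonempty open set is never contained in the hyperplane, and a convex set that reaches both sides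
  crosses it; hence \<open>\<Delta> = \<Delta>\<^sub>1 \<union> \<Delta>\<^sub>2\<close>, and \<open>\<Delta>\<^sub>1 \<inter> \<Delta>\<^sub>2\<close> is the nerve of the traces on the hyperplane,
  which is a copy of \<open>\<real>\<^sup>d\<^sup>-\<^sup>1\<close> (lemma \<open>cover_nerve_hyperplane_split\<close>).

  All four collapses come from one statement: the nerve of a convex open cover with convex union
  collapses onto the nerve of its trace on an open half-space.  This gives \<open>\<Delta> \<rightarrow> \<Delta>\<^sub>1\<close> and \<open>\<Delta> \<rightarrow> \<Delta>\<^sub>2\<close>;
  and a collapse of \<open>\<Delta>\<close> onto \<open>\<Delta>\<^sub>1\<close> only removes faces of \<open>\<Delta>\<^sub>2\<close>, so the same steps collapse \<open>\<Delta>\<^sub>2\<close>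
  onto \<open>\<Delta>\<^sub>1 \<inter> \<Delta>\<^sub>2\<close> (lemma \<open>collapses_onto_restrict\<close>).

  For that statement the open sets are first shrunk to compact convex sets \<open>K i\<close>, without changing
  the two nerves and keeping the union convex (lemma \<open>compact_shrinking\<close>), and the half-space is
  replaced by a large ball tangent to its boundary.  It then remains to collapse the nerve of
  the \<open>K i\<close> onto the nerve of their traces on a ball, by letting a huge ball shrink to the given one
  and removing faces in the order in which the ball loses them.  Let \<open>\<sigma>\<close> be a minimal face among those
  lost first.  Thickening the sets \<open>K j\<close> with \<open>j \<notin> \<sigma>\<close> a little inside the union changes neither the
  nerves nor the union, and afterwards the faces lost first are exactly the faces that contain \<open>\<sigma>\<close>.
  All their intersections contain the point \<open>p\<close> of the intersection of \<open>\<sigma>\<close> nearest to the centre; so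
  they form the interval from \<open>\<sigma>\<close> to the set \<open>F\<close> of all \<open>i\<close> with \<open>p \<in> K i\<close>, and removing them is an elementary collapse
  unless \<open>F = \<sigma>\<close>.  In that case the \<open>K i\<close> with \<open>i \<in> \<sigma>\<close> would cover a convex set near \<open>p\<close>, slightly closer to
  the centre, in which any proper subfamily has a common point but the whole family has none.
  This is impossible by a theorem of Klee and Berge (lemma \<open>convex_cover_intersection\<close>).
\<close>


section \<open>Elementary collapses\<close>

lemma collapses_onto_subset: "collapses_onto \<Delta> \<Gamma> \<Longrightarrow> \<Gamma> \<subseteq> \<Delta>"
  unfolding collapses_onto_def
  by (induction rule: rtranclp_induct) (auto simp: elementary_collapse_def deletion_def)

text \<open>
  Freeness of \<open>\<sigma>\<close> only depends on the faces that contain \<open>\<sigma>\<close>, so it is inherited by any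
  subcollection that keeps all of them.
\<close>

lemma elementary_collapse_restrict:
  assumes free: "free_face X \<sigma>" and "Z \<subseteq> X" and star: "\<And>\<tau>. \<tau> \<in> X \<Longrightarrow> \<sigma> \<subseteq> \<tau> \<Longrightarrow> \<tau> \<in> Z"
  shows "elementary_collapse Z (Z \<inter> deletion X \<sigma>)"
proof -
  have facet_iff: "facet Z F \<longleftrightarrow> facet X F" if "\<sigma> \<subseteq> F" for F
    using that \<open>Z \<subseteq> X\<close> star unfolding facet_def by (meson subset_iff subset_trans)
  have "\<sigma> \<in> Z"
    using free star by (auto simp: free_face_def)
  moreover have "\<not> facet Z \<sigma>"
    using free facet_iff by (auto simp: free_face_def)
  moreover have "\<exists>!F. facet Z F \<and> \<sigma> \<subseteq> F"
    using free facet_iff unfolding free_face_def by blast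
  ultimately have "free_face Z \<sigma>"
    by (simp add: free_face_def)
  moreover have "Z \<inter> deletion X \<sigma> = deletion Z \<sigma>"
    using \<open>Z \<subseteq> X\<close> by (auto simp: deletion_def)
  ultimately show ?thesis
    by (auto simp: elementary_collapse_def)
qed

text \<open>
  Every step of the collapse uses a free face outside \<open>Y\<close>, and \<open>Z\<close> has the same faces outside \<open>Y\<close> as
  \<open>X\<close>; so each step can also be carried out in \<open>Z\<close>.
\<close>

lemma collapses_onto_restrict:
  assumes "collapses_onto X Y" and "Z \<subseteq> X" and "X - Y \<subseteq> Z"
  shows "collapses_onto Z (Z \<inter> Y)"
  using assms unfolding collapses_onto_def
proof (induction arbitrary: Z rule: converse_rtranclp_induct)
  case base
  then show ?case by (simp add: Int_absorb2)
next
  case (step X X')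
  obtain \<sigma> where \<sigma>: "free_face X \<sigma>" "X' = deletion X \<sigma>"
    using step.hyps(1) by (auto simp: elementary_collapse_def)
  have "Y \<subseteq> X'"
    using step.hyps(2) collapses_onto_subset by (simp add: collapses_onto_def)
  then have "elementary_collapse Z (Z \<inter> X')"
    using step.prems \<sigma>(2) unfolding \<sigma>(2)
    by (intro elementary_collapse_restrict[OF \<sigma>(1)]) (auto simp: deletion_def)
  moreover have "elementary_collapse\<^sup>*\<^sup>* (Z \<inter> X') (Z \<inter> X' \<inter> Y)"
    using step.prems \<sigma>(2) by (intro step.IH) (auto simp: deletion_def)
  moreover have "Z \<inter> X' \<inter> Y = Z \<inter> Y"
    using \<open>Y \<subseteq> X'\<close> by blast
  ultimately show ?case
    by (metis converse_rtranclp_into_rtranclp)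
qed

lemma elementary_collapse_interval:
  assumes "\<And>\<tau>. \<tau> \<in> \<Delta> \<Longrightarrow> \<sigma> \<subseteq> \<tau> \<Longrightarrow> \<tau> \<subseteq> F" and "\<sigma> \<in> \<Delta>" and "F \<in> \<Delta>" and "\<sigma> \<subset> F"
  shows "elementary_collapse \<Delta> (deletion \<Delta> \<sigma>)"
proof -
  have "facet \<Delta> F"
    unfolding facet_def using assms by (meson psubset_imp_subset subset_antisym subset_trans)
  moreover have "G = F" if "facet \<Delta> G" "\<sigma> \<subseteq> G" for G
    using assms(1)[of G] assms(3) that by (auto simp: facet_def)
  moreover have "\<not> facet \<Delta> \<sigma>"
    using assms(3,4) unfolding facet_def by blast
  ultimately have "free_face \<Delta> \<sigma>"
    unfolding free_face_def using assms(2,4) psubset_imp_subset by (intro conjI ex1I[of _ F]) blast+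
  then show ?thesis
    by (auto simp: elementary_collapse_def)
qed

section \<open>Nerves of covers\<close>

text \<open>
  Points are taken from the union even when \<open>\<sigma>\<close> is empty.  When the union is convex, this
  agrees with \<^const>\<open>face_region\<close> on the subsets of \<open>V\<close>, without a case distinction for the empty face
  and for points of any type.
\<close>

definition cover_region :: "'v set \<Rightarrow> ('v \<Rightarrow> 'a set) \<Rightarrow> 'v set \<Rightarrow> 'a set"
  where "cover_region V U \<sigma> = {x \<in> \<Union>i\<in>V. U i. \<forall>i\<in>\<sigma>. x \<in> U i}"

definition cover_nerve :: "'v set \<Rightarrow> ('v \<Rightarrow> 'a set) \<Rightarrow> 'v set set"
  where "cover_nerve V U = {\<sigma>. \<sigma> \<subseteq> V \<and> cover_region V U \<sigma> \<noteq> {}}"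

lemma cover_region_antimono: "\<sigma> \<subseteq> \<tau> \<Longrightarrow> cover_region V U \<tau> \<subseteq> cover_region V U \<sigma>"
  by (auto simp: cover_region_def)

lemma cover_region_mono: "(\<And>i. i \<in> V \<Longrightarrow> U i \<subseteq> W i) \<Longrightarrow> \<sigma> \<subseteq> V \<Longrightarrow> cover_region V U \<sigma> \<subseteq> cover_region V W \<sigma>"
  by (fastforce simp: cover_region_def)

lemma cover_nerve_mono: "(\<And>i. i \<in> V \<Longrightarrow> U i \<subseteq> W i) \<Longrightarrow> cover_nerve V U \<subseteq> cover_nerve V W"
  unfolding cover_nerve_def using cover_region_mono[of V U W] by blast

lemma cover_region_Int: "cover_region V (\<lambda>i. U i \<inter> C) \<sigma> = cover_region V U \<sigma> \<inter> C"
  by (auto simp: cover_region_def)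

lemma cover_region_nonempty: "\<sigma> \<noteq> {} \<Longrightarrow> \<sigma> \<subseteq> V \<Longrightarrow> cover_region V U \<sigma> = (\<Inter>i\<in>\<sigma>. U i)"
  by (auto simp: cover_region_def)

lemma cover_region_empty: "cover_region V U {} = (\<Union>i\<in>V. U i)"
  by (auto simp: cover_region_def)

lemma cover_region_vimage:
  "cover_region V (\<lambda>i. f -` U i) \<sigma> = f -` cover_region V U \<sigma>"
  by (auto simp: cover_region_def)

lemma cover_nerve_vimage:
  assumes "(\<Union>i\<in>V. U i) \<subseteq> range f"
  shows "cover_nerve V (\<lambda>i. f -` U i) = cover_nerve V U"
proof -
  have "f -` cover_region V U \<sigma> \<noteq> {} \<longleftrightarrow> cover_region V U \<sigma> \<noteq> {}" for \<sigma>
  proof -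
    have "cover_region V U \<sigma> \<subseteq> range f"
      using assms by (auto simp: cover_region_def)
    then show ?thesis by blast
  qed
  then show ?thesis
    by (simp add: cover_nerve_def cover_region_vimage)
qed

lemma cover_nerve_downward: "\<sigma> \<in> cover_nerve V U \<Longrightarrow> \<tau> \<subseteq> \<sigma> \<Longrightarrow> \<tau> \<in> cover_nerve V U"
  using cover_region_antimono[of \<tau> \<sigma> V U] by (auto simp: cover_nerve_def)

lemma convex_cover_region:
  assumes "\<And>i. i \<in> V \<Longrightarrow> convex (U i)" "convex (\<Union>i\<in>V. U i)" "\<sigma> \<subseteq> V"
  shows "convex (cover_region V U \<sigma>)"
proof -
  have "cover_region V U \<sigma> = (\<Union>i\<in>V. U i) \<inter> (\<Inter>i\<in>\<sigma>. U i)"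
    by (auto simp: cover_region_def)
  then show ?thesis
    using assms by (auto intro!: convex_Int convex_INT)
qed

lemma compact_cover_region:
  fixes U :: "'v \<Rightarrow> 'a::t2_space set"
  assumes "finite V" "\<And>i. i \<in> V \<Longrightarrow> compact (U i)" "\<sigma> \<subseteq> V"
  shows "compact (cover_region V U \<sigma>)"
proof -
  have "cover_region V U \<sigma> = (\<Union>i\<in>V. U i) \<inter> (\<Inter>i\<in>\<sigma>. U i)"
    by (auto simp: cover_region_def)
  moreover have "compact (\<Union>i\<in>V. U i)"
    using assms by auto
  moreover have "closed (\<Inter>i\<in>\<sigma>. U i)"
    using assms by (blast intro: compact_imp_closed)
  ultimately show ?thesis
    using compact_Int_closed by metis
qed

lemma openin_cover_region:
  assumes "finite V" "\<And>i. i \<in> V \<Longrightarrow> openin T (U i)" "\<sigma> \<subseteq> V"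
  shows "openin T (cover_region V U \<sigma>)"
proof (cases "\<sigma> = {}")
  case True
  then show ?thesis using assms by (auto simp: cover_region_empty)
next
  case False
  then show ?thesis
    using assms by (auto simp: cover_region_nonempty intro!: openin_INT2 finite_subset[OF assms(3)])
qed

lemma nerve_eq_cover_nerve:
  assumes "convex (\<Union>i\<in>V. U i)"
  shows "nerve V U = cover_nerve V U"
proof -
  have "face_region V U \<sigma> = cover_region V U \<sigma>" if "\<sigma> \<subseteq> V" for \<sigma>
    using that assms by (simp add: face_region_def cover_region_empty cover_region_nonempty hull_same)
  then show ?thesis
    by (auto simp: nerve_def cover_nerve_def)
qed

section \<open>Convex sets with convex union\<close>

lemma compact_convex_strict_separation:
  fixes A B :: "'a::real_inner set"
  assumes "convex A" "compact A" "A \<noteq> {}" "convex B" "compact B" "B \<noteq> {}" "A \<inter> B = {}"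
  obtains \<nu> b where "\<And>x. x \<in> A \<Longrightarrow> inner \<nu> x < b" "\<And>x. x \<in> B \<Longrightarrow> b < inner \<nu> x"
proof -
  have "\<exists>p\<in>A \<times> B. \<forall>q\<in>A \<times> B. dist (fst p) (snd p) \<le> dist (fst q) (snd q)"
    using assms by (intro continuous_attains_inf compact_Times continuous_intros) auto
  then obtain x y where xy: "x \<in> A" "y \<in> B" and
    min: "\<And>u v. u \<in> A \<Longrightarrow> v \<in> B \<Longrightarrow> dist x y \<le> dist u v"
    by fastforce
  let ?\<nu> = "y - x"
  let ?b = "inner ?\<nu> ((1/2) *\<^sub>R (x + y))"
  have pos: "inner ?\<nu> ?\<nu> > 0"
    using xy assms(7) by auto
  have "inner ?\<nu> u < ?b" if "u \<in> A" for u
  proof -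
    have "inner (y - x) (u - x) \<le> 0"
      using assms xy min that
      by (intro any_closest_point_dot[of A]) (auto simp: compact_imp_closed dist_commute)
    then show ?thesis
      using pos by (simp add: inner_simps inner_commute)
  qed
  moreover have "?b < inner ?\<nu> v" if "v \<in> B" for v
  proof -
    have "inner (x - y) (v - y) \<le> 0"
      using assms xy min that
      by (intro any_closest_point_dot[of B]) (auto simp: compact_imp_closed)
    then show ?thesis
      using pos by (simp add: inner_simps inner_commute)
  qed
  ultimately show ?thesis
    using that by blast
qed

lemma segment_meets_hyperplane:
  fixes h :: "'a::real_vector \<Rightarrow> real"
  assumes "linear h" "convex C" "x \<in> C" "y \<in> C" "h x < b" "b < h y"
  shows "\<exists>z\<in>C. h z = b"
proof -
  define t where "t = (b - h x) / (h y - h x)"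
  have t: "0 \<le> t" "t \<le> 1"
    using assms by (auto simp: t_def divide_simps)
  have "t * (h y - h x) = b - h x"
    using assms by (simp add: t_def)
  then have "h ((1 - t) *\<^sub>R x + t *\<^sub>R y) = b"
    using assms(1) by (simp add: linear_add linear_diff linear_scale algebra_simps)
  moreover have "(1 - t) *\<^sub>R x + t *\<^sub>R y \<in> C"
    using assms t by (simp add: convexD_alt)
  ultimately show ?thesis by blast
qed

text \<open>
  The theorem of Klee and Berge, by induction on the number of sets.  If the sets indexed by
  \<open>insert k F\<close> had no common point in \<open>Q\<close>, then the trace of \<open>K k\<close> and the common part of the others
  would be disjoint, and a hyperplane would separate them strictly.  The others cover the part of \<open>Q\<close> in that hyperplane,
  and satisfy the hypothesis there, because the common part of all but one of them has points on both
  sides.  By induction they would have a common point on the hyperplane, contradicting the separation.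
\<close>

lemma convex_cover_intersection:
  fixes K :: "'v \<Rightarrow> 'a::real_inner set"
  assumes "finite F" "F \<noteq> {}" "compact Q" "convex Q"
    and "\<And>i. i \<in> F \<Longrightarrow> closed (K i)" "\<And>i. i \<in> F \<Longrightarrow> convex (K i)" "Q \<subseteq> (\<Union>i\<in>F. K i)"
    and "\<And>i. i \<in> F \<Longrightarrow> Q \<inter> (\<Inter>j\<in>F - {i}. K j) \<noteq> {}"
  shows "Q \<inter> (\<Inter>j\<in>F. K j) \<noteq> {}"
  using assms
proof (induction arbitrary: Q rule: finite_ne_induct)
  case (singleton k)
  have "Q \<noteq> {}" using singleton.prems(6)[of k] by auto
  then show ?case using singleton.prems(5) by auto
next
  case (insert k F)
  note K = insert.prems(3,4)
  define A where "A = Q \<inter> K k"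
  define B where "B = Q \<inter> (\<Inter>j\<in>F. K j)"
  show ?case
  proof (rule ccontr)
    assume contr: "\<not> ?case"
    have "B \<noteq> {}"
    proof -
      have "insert k F - {k} = F" using insert.hyps by auto
      then show ?thesis using insert.prems(6)[of k] by (auto simp: B_def)
    qed
    obtain i where "i \<in> F" using insert.hyps by auto
    then have "A \<noteq> {}"
      using insert.prems(6)[of i] insert.hyps by (auto simp: A_def)
    have "A \<inter> B = {}" using contr by (auto simp: A_def B_def)
    moreover have "convex A" "convex B"
      using insert.prems(2) K by (auto simp: A_def B_def intro!: convex_Int convex_INT)
    moreover have "compact A" "compact B"
      using insert.prems(1) K
      by (auto simp: A_def B_def intro!: compact_Int_closed closed_INT)
    ultimately obtain \<nu> b where sep: "\<And>x. x \<in> A \<Longrightarrow> inner \<nu> x < b" "\<And>x. x \<in> B \<Longrightarrow> b < inner \<nu> x"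
      using compact_convex_strict_separation \<open>A \<noteq> {}\<close> \<open>B \<noteq> {}\<close> by metis
    define Q' where "Q' = Q \<inter> {x. inner \<nu> x = b}"
    have "Q' \<inter> (\<Inter>j\<in>F. K j) \<noteq> {}"
    proof (rule insert.IH)
      show "compact Q'"
        unfolding Q'_def using insert.prems(1) by (intro compact_Int_closed closed_hyperplane)
      show "convex Q'"
        unfolding Q'_def using insert.prems(2) by (intro convex_Int convex_hyperplane)
      show "Q' \<subseteq> (\<Union>i\<in>F. K i)"
        using insert.prems(5) sep(1) by (fastforce simp: Q'_def A_def)
      show "Q' \<inter> (\<Inter>j\<in>F - {i}. K j) \<noteq> {}" if "i \<in> F" for i
      proof -
        have "\<exists>x. x \<in> Q \<inter> (\<Inter>j\<in>insert k F - {i}. K j)"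
          unfolding ex_in_conv using that by (intro insert.prems(6)) simp
        then obtain x where x: "x \<in> Q" "\<And>j. j \<in> insert k F - {i} \<Longrightarrow> x \<in> K j"
          by blast
        then have "x \<in> A"
          using that insert.hyps by (auto simp: A_def)
        obtain y where "y \<in> B" using \<open>B \<noteq> {}\<close> by auto
        have "convex (Q \<inter> (\<Inter>j\<in>F - {i}. K j))"
          using insert.prems(2) K by (auto intro!: convex_Int convex_INT)
        moreover have "x \<in> Q \<inter> (\<Inter>j\<in>F - {i}. K j)" "y \<in> Q \<inter> (\<Inter>j\<in>F - {i}. K j)"
          using x \<open>y \<in> B\<close> by (auto simp: B_def)
        ultimately have "\<exists>z\<in>Q \<inter> (\<Inter>j\<in>F - {i}. K j). inner \<nu> z = b"
          using sep(1)[OF \<open>x \<in> A\<close>] sep(2)[OF \<open>y \<in> B\<close>]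
          by (rule segment_meets_hyperplane[OF bounded_linear.linear[OF bounded_linear_inner_right]])
        then show ?thesis by (auto simp: Q'_def)
      qed
    qed (use K in auto)
    then show False
      using sep(2) by (fastforce simp: Q'_def B_def)
  qed
qed

text \<open>
  The compact case applies to the convex hull of one point from each of the intersections that are
  assumed to be nonempty.
\<close>

lemma convex_cover_intersection_convex:
  fixes K :: "'v \<Rightarrow> 'a::real_inner set"
  assumes F: "finite F" "F \<noteq> {}" and Q: "convex Q"
    and K: "\<And>i. i \<in> F \<Longrightarrow> closed (K i)" "\<And>i. i \<in> F \<Longrightarrow> convex (K i)" and cov: "Q \<subseteq> (\<Union>i\<in>F. K i)"
    and meet: "\<And>i. i \<in> F \<Longrightarrow> Q \<inter> (\<Inter>j\<in>F - {i}. K j) \<noteq> {}"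
  shows "Q \<inter> (\<Inter>j\<in>F. K j) \<noteq> {}"
proof -
  have "\<forall>i\<in>F. \<exists>y. y \<in> Q \<inter> (\<Inter>j\<in>F - {i}. K j)"
    unfolding ex_in_conv using meet by (intro ballI)
  from bchoice[OF this] obtain y where y: "\<And>i. i \<in> F \<Longrightarrow> y i \<in> Q \<inter> (\<Inter>j\<in>F - {i}. K j)"
    by blast
  let ?S = "convex hull (y ` F)"
  have "?S \<subseteq> Q"
    using y Q by (intro hull_minimal) auto
  moreover have "?S \<inter> (\<Inter>j\<in>F. K j) \<noteq> {}"
  proof (rule convex_cover_intersection)
    show "?S \<inter> (\<Inter>j\<in>F - {i}. K j) \<noteq> {}" if "i \<in> F" for i
    proof -
      have "y i \<in> ?S \<inter> (\<Inter>j\<in>F - {i}. K j)"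
        using that y[OF that] by (auto intro: hull_inc)
      then show ?thesis by blast
    qed
  qed (use assms \<open>?S \<subseteq> Q\<close> in \<open>auto intro: finite_imp_compact_convex_hull\<close>)
  ultimately show ?thesis by blast
qed

section \<open>Thickening compact sets\<close>

text \<open>
  The closed \<open>\<epsilon>\<close>-neighbourhood, as a Minkowski sum, since sums of convex sets are convex
  and the sum of a compact and a closed set is closed.
\<close>

definition thickening :: "'a::real_normed_vector set \<Rightarrow> real \<Rightarrow> 'a set"
  where "thickening K \<epsilon> = (\<Union>x\<in>K. \<Union>y\<in>cball 0 \<epsilon>. {x + y})"

lemma mem_thickening: "x \<in> thickening K \<epsilon> \<longleftrightarrow> (\<exists>y\<in>K. dist y x \<le> \<epsilon>)"
proof -
  have "(\<exists>z\<in>cball 0 \<epsilon>. x = y + z) \<longleftrightarrow> dist y x \<le> \<epsilon>" for y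
    by (force simp: dist_norm norm_minus_commute intro: bexI[of _ "x - y"])
  then show ?thesis
    by (auto simp: thickening_def)
qed

lemma subset_thickening: "0 \<le> \<epsilon> \<Longrightarrow> K \<subseteq> thickening K \<epsilon>"
  by (metis dist_self mem_thickening subsetI)

lemma convex_thickening: "convex K \<Longrightarrow> convex (thickening K \<epsilon>)"
  unfolding thickening_def by (intro convex_sums) auto

lemma closed_thickening: "compact K \<Longrightarrow> closed (thickening K \<epsilon>)"
  unfolding thickening_def using compact_closed_sums[of K "cball 0 \<epsilon>"]
  by (simp add: closed_compact_sums)

text \<open>
  The sum of the distances to the sets \<open>K i\<close> has a positive minimum on \<open>C\<close>, whereas it is at most
  \<open>card \<tau> * \<epsilon>\<close> at a common point of the thickenings.
\<close>

lemma eventually_thickening_disjoint: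
  fixes K :: "'v \<Rightarrow> 'a::real_normed_vector set"
  assumes "finite \<tau>" "compact C" "\<And>i. i \<in> \<tau> \<Longrightarrow> compact (K i)" "C \<inter> (\<Inter>i\<in>\<tau>. K i) = {}"
  shows "eventually (\<lambda>\<epsilon>. C \<inter> (\<Inter>i\<in>\<tau>. thickening (K i) \<epsilon>) = {}) (at_right (0::real))"
proof (cases "C = {} \<or> (\<exists>i\<in>\<tau>. K i = {})")
  case True
  then show ?thesis
    by (auto simp: thickening_def intro!: always_eventually)
next
  case False
  define f where "f x = (\<Sum>i\<in>\<tau>. infdist x (K i))" for x
  have "\<exists>x\<in>C. \<forall>y\<in>C. f x \<le> f y"
    using False assms unfolding f_def by (intro continuous_attains_inf continuous_intros) auto
  then obtain x where x: "x \<in> C" "\<And>y. y \<in> C \<Longrightarrow> f x \<le> f y" by blast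
  obtain i where i: "i \<in> \<tau>" "x \<notin> K i" using assms x by blast
  have "infdist x (K i) > 0"
    using i False assms by (metis compact_imp_closed in_closed_iff_infdist_zero infdist_nonneg order_le_less)
  moreover have "infdist x (K i) \<le> f x"
    unfolding f_def by (intro member_le_sum) (use i assms in \<open>auto simp: infdist_nonneg\<close>)
  ultimately have "f x > 0" by linarith
  have "card \<tau> > 0"
    using i assms(1) by (auto simp: card_gt_0_iff)
  have "C \<inter> (\<Inter>i\<in>\<tau>. thickening (K i) \<epsilon>) = {}" if "0 < \<epsilon>" "\<epsilon> < f x / card \<tau>" for \<epsilon>
  proof (rule ccontr)
    assume "C \<inter> (\<Inter>i\<in>\<tau>. thickening (K i) \<epsilon>) \<noteq> {}"
    then obtain y where y: "y \<in> C" "\<And>i. i \<in> \<tau> \<Longrightarrow> y \<in> thickening (K i) \<epsilon>" by blast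
    have "infdist y (K i) \<le> \<epsilon>" if "i \<in> \<tau>" for i
      using y(2)[OF that] by (auto simp: mem_thickening dist_commute intro: infdist_le2)
    then have "f y \<le> card \<tau> * \<epsilon>"
      unfolding f_def using sum_bounded_above[of \<tau> "\<lambda>i. infdist y (K i)" \<epsilon>] by simp
    moreover have "card \<tau> * \<epsilon> < f x"
      using that \<open>card \<tau> > 0\<close> by (simp add: field_simps)
    ultimately show False using x(2)[OF y(1)] by linarith
  qed
  moreover have "f x / card \<tau> > 0"
    using \<open>f x > 0\<close> \<open>card \<tau> > 0\<close> by simp
  ultimately show ?thesis
    unfolding eventually_at_right_field by blast
qed

text \<open>
  The perturbation that makes the sweep generic.  Cutting the thickenings off at the union of
  the cover keeps that union, and in particular its convexity.
\<close>

definition thicken_outside ::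
    "'v set \<Rightarrow> ('v \<Rightarrow> 'a::real_normed_vector set) \<Rightarrow> 'v set \<Rightarrow> real \<Rightarrow> 'v \<Rightarrow> 'a set"
  where "thicken_outside V K \<sigma> \<epsilon> = (\<lambda>i. if i \<in> \<sigma> then K i else (\<Union>j\<in>V. K j) \<inter> thickening (K i) \<epsilon>)"

lemma thicken_outside_superset: "i \<in> V \<Longrightarrow> 0 < \<epsilon> \<Longrightarrow> K i \<subseteq> thicken_outside V K \<sigma> \<epsilon> i"
  using subset_thickening[of \<epsilon> "K i"] by (auto simp: thicken_outside_def)

lemma Union_thicken_outside:
  assumes "0 < \<epsilon>"
  shows "(\<Union>i\<in>V. thicken_outside V K \<sigma> \<epsilon> i) = (\<Union>i\<in>V. K i)"
proof
  show "(\<Union>i\<in>V. thicken_outside V K \<sigma> \<epsilon> i) \<subseteq> (\<Union>i\<in>V. K i)"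
    by (auto simp: thicken_outside_def split: if_splits)
  show "(\<Union>i\<in>V. K i) \<subseteq> (\<Union>i\<in>V. thicken_outside V K \<sigma> \<epsilon> i)"
    using thicken_outside_superset[OF _ assms, of _ V K \<sigma>] by blast
qed

lemma eventually_cover_region_thicken_empty:
  fixes K :: "'v \<Rightarrow> 'a::real_normed_vector set"
  assumes V: "finite V" and K: "\<And>i. i \<in> V \<Longrightarrow> compact (K i)" and "closed C" and "\<tau> \<subseteq> V"
    and empty: "cover_region V K \<tau> \<inter> C = {}"
  shows "eventually (\<lambda>\<epsilon>. cover_region V (thicken_outside V K \<sigma> \<epsilon>) \<tau> \<inter> C = {}) (at_right 0)"
proof -
  let ?P = "\<Union>i\<in>V. K i"
  have "eventually (\<lambda>\<epsilon>. (?P \<inter> C) \<inter> (\<Inter>i\<in>\<tau>. thickening (K i) \<epsilon>) = {}) (at_right (0::real))"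
  proof (rule eventually_thickening_disjoint)
    show "compact (?P \<inter> C)"
      using V K \<open>closed C\<close> by (intro compact_Int_closed compact_UN) auto
    show "?P \<inter> C \<inter> (\<Inter>i\<in>\<tau>. K i) = {}"
      using empty by (auto simp: cover_region_def)
  qed (use assms finite_subset in auto)
  moreover have "eventually (\<lambda>\<epsilon>. \<epsilon> > 0) (at_right (0::real))"
    by (rule eventually_at_right_less)
  ultimately show ?thesis
  proof eventually_elim
    case (elim \<epsilon>)
    have "thicken_outside V K \<sigma> \<epsilon> i \<subseteq> thickening (K i) \<epsilon>" if "i \<in> V" for i
      using elim(2) subset_thickening[of \<epsilon> "K i"] by (auto simp: thicken_outside_def)
    then have "cover_region V (thicken_outside V K \<sigma> \<epsilon>) \<tau> \<subseteq> ?P \<inter> (\<Inter>i\<in>\<tau>. thickening (K i) \<epsilon>)"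
      using \<open>\<tau> \<subseteq> V\<close> Union_thicken_outside[OF elim(2), of V K \<sigma>] by (fastforce simp: cover_region_def)
    then show ?case
      using elim(1) by blast
  qed
qed

lemma eventually_cover_nerve_thicken:
  fixes K :: "'v \<Rightarrow> 'a::real_normed_vector set"
  assumes V: "finite V" and K: "\<And>i. i \<in> V \<Longrightarrow> compact (K i)" and C: "closed C"
  shows "eventually (\<lambda>\<epsilon>. cover_nerve V (\<lambda>i. thicken_outside V K \<sigma> \<epsilon> i \<inter> C)
           = cover_nerve V (\<lambda>i. K i \<inter> C)) (at_right 0)"
proof -
  let ?bad = "{\<tau>. \<tau> \<subseteq> V \<and> cover_region V K \<tau> \<inter> C = {}}"
  have "finite ?bad" using V by simp
  then have "eventually (\<lambda>\<epsilon>. \<forall>\<tau>\<in>?bad. cover_region V (thicken_outside V K \<sigma> \<epsilon>) \<tau> \<inter> C = {}) (at_right 0)"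
    using eventually_cover_region_thicken_empty[OF V K C]
    by (intro eventually_ball_finite) auto
  moreover have "eventually (\<lambda>\<epsilon>. \<epsilon> > 0) (at_right (0::real))"
    by (rule eventually_at_right_less)
  ultimately show ?thesis
  proof eventually_elim
    case (elim \<epsilon>)
    have "cover_nerve V (\<lambda>i. K i \<inter> C) \<subseteq> cover_nerve V (\<lambda>i. thicken_outside V K \<sigma> \<epsilon> i \<inter> C)"
      using thicken_outside_superset[OF _ elim(2), of _ V K \<sigma>] by (intro cover_nerve_mono) blast
    moreover have "cover_nerve V (\<lambda>i. thicken_outside V K \<sigma> \<epsilon> i \<inter> C) \<subseteq> cover_nerve V (\<lambda>i. K i \<inter> C)"
      using elim(1) by (auto simp: cover_nerve_def cover_region_Int)
    ultimately show ?case by auto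
  qed
qed

section \<open>Sweeping with a shrinking ball\<close>

lemma segment_closer:
  fixes a x y :: "'a::real_normed_vector"
  assumes "dist a y < dist a x" "0 < t" "t \<le> 1"
  shows "dist a ((1 - t) *\<^sub>R x + t *\<^sub>R y) < dist a x"
proof -
  have "a - ((1 - t) *\<^sub>R x + t *\<^sub>R y) = (1 - t) *\<^sub>R (a - x) + t *\<^sub>R (a - y)"
    by (simp add: algebra_simps)
  then have "dist a ((1 - t) *\<^sub>R x + t *\<^sub>R y) \<le> (1 - t) * dist a x + t * dist a y"
    unfolding dist_norm using norm_triangle_ineq[of "(1 - t) *\<^sub>R (a - x)" "t *\<^sub>R (a - y)"] assms(2,3)
    by simp
  also have "\<dots> < (1 - t) * dist a x + t * dist a x"
    using assms by simp
  finally show ?thesis by (simp add: algebra_simps)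
qed

lemma segment_near:
  fixes x y :: "'a::real_normed_vector"
  assumes "0 < e"
  obtains t where "0 < t" "t \<le> 1" "dist x ((1 - t) *\<^sub>R x + t *\<^sub>R y) < e"
proof
  define t where "t = min 1 (e / (norm (x - y) + 1) )"
  have pos: "norm (x - y) + 1 > 0" by (simp add: add_nonneg_pos)
  show "0 < t" "t \<le> 1" using pos assms by (auto simp: t_def)
  have "x - ((1 - t) *\<^sub>R x + t *\<^sub>R y) = t *\<^sub>R (x - y)"
    by (simp add: algebra_simps)
  then have "dist x ((1 - t) *\<^sub>R x + t *\<^sub>R y) = t * norm (x - y)"
    using \<open>0 < t\<close> by (simp add: dist_norm)
  also have "\<dots> < t * (norm (x - y) + 1)" using \<open>0 < t\<close> by simp
  also have "\<dots> \<le> e"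
    using pos by (simp add: t_def flip: pos_le_divide_eq)
  finally show "dist x ((1 - t) *\<^sub>R x + t *\<^sub>R y) < e" .
qed

text \<open>
  One elementary collapse of the sweep.  The number \<open>m \<tau>\<close> below is the radius at which the shrinking
  ball around \<open>a\<close> loses the face \<open>\<tau>\<close>, and \<open>c\<close> is the largest of these radii.  The new family \<open>K'\<close> is the
  thickened family cut off by a ball whose radius lies between \<open>r\<close> and \<open>c\<close> and is large
  enough to keep all faces that are not lost at radius \<open>c\<close>.
\<close>

lemma sweep_step:
  fixes K :: "'v \<Rightarrow> 'a::real_inner set" and a :: 'a
  assumes V: "finite V" and K: "\<And>i. i \<in> V \<Longrightarrow> compact (K i)" "\<And>i. i \<in> V \<Longrightarrow> convex (K i)"
    and P: "convex (\<Union>i\<in>V. K i)"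
    and ne: "cover_nerve V K \<noteq> cover_nerve V (\<lambda>i. K i \<inter> cball a r)"
  obtains K' where "\<And>i. i \<in> V \<Longrightarrow> compact (K' i)" "\<And>i. i \<in> V \<Longrightarrow> convex (K' i)"
    "convex (\<Union>i\<in>V. K' i)" "elementary_collapse (cover_nerve V K) (cover_nerve V K')"
    "cover_nerve V (\<lambda>i. K' i \<inter> cball a r) = cover_nerve V (\<lambda>i. K i \<inter> cball a r)"
proof -
  let ?N = "cover_nerve V K" and ?P = "\<Union>i\<in>V. K i"
  have finN: "finite ?N"
    using V by (auto simp: cover_nerve_def)
  have "\<exists>x\<in>cover_region V K \<tau>. \<forall>y\<in>cover_region V K \<tau>. dist a x \<le> dist a y" if "\<tau> \<in> ?N" for \<tau>
    using that compact_cover_region[of V K \<tau>] V K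
    by (intro continuous_attains_inf continuous_intros) (auto simp: cover_nerve_def)
  then obtain near where near: "\<And>\<tau>. \<tau> \<in> ?N \<Longrightarrow> near \<tau> \<in> cover_region V K \<tau>"
      "\<And>\<tau> y. \<tau> \<in> ?N \<Longrightarrow> y \<in> cover_region V K \<tau> \<Longrightarrow> dist a (near \<tau>) \<le> dist a y"
    by metis
  define m where "m \<tau> = dist a (near \<tau>)" for \<tau>
  define c where "c = Max (m ` ?N)"
  obtain \<rho> where \<rho>: "\<rho> \<in> ?N" "\<rho> \<notin> cover_nerve V (\<lambda>i. K i \<inter> cball a r)"
    using ne cover_nerve_mono[of V "\<lambda>i. K i \<inter> cball a r" K] by auto
  have "m \<rho> > r"
    using near(1)[OF \<rho>(1)] \<rho> unfolding m_def cover_nerve_def cover_region_Int by force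
  have m_le: "m \<tau> \<le> c" if "\<tau> \<in> ?N" for \<tau>
    unfolding c_def using that finN by simp
  have "r < c" using \<open>m \<rho> > r\<close> m_le[OF \<rho>(1)] by linarith
  have "c \<in> m ` ?N" unfolding c_def using \<rho>(1) finN by (intro Max_in) auto
  then have "{\<tau> \<in> ?N. m \<tau> = c} \<noteq> {}" by auto
  then obtain \<sigma> where "\<sigma> \<in> {\<tau> \<in> ?N. m \<tau> = c}"
    and minimal: "\<And>\<tau>. \<tau> \<in> {\<tau> \<in> ?N. m \<tau> = c} \<Longrightarrow> \<tau> \<subseteq> \<sigma> \<Longrightarrow> \<sigma> = \<tau>"
    using finite_has_minimal[of "{\<tau> \<in> ?N. m \<tau> = c}"] finN by auto
  then have \<sigma>: "\<sigma> \<in> ?N" "m \<sigma> = c" by auto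
  have "\<sigma> \<subseteq> V" using \<sigma> by (simp add: cover_nerve_def)
  have m_less: "m \<tau> < c" if "\<tau> \<subset> \<sigma>" for \<tau>
  proof -
    have "\<tau> \<in> ?N" using that \<sigma>(1) cover_nerve_downward by blast
    then show ?thesis using minimal[of \<tau>] m_le[of \<tau>] that by fastforce
  qed
  let ?T = "thicken_outside V K \<sigma>"
  have "eventually (\<lambda>\<epsilon>. cover_nerve V (\<lambda>i. ?T \<epsilon> i \<inter> UNIV) = cover_nerve V (\<lambda>i. K i \<inter> UNIV)) (at_right 0)"
    "eventually (\<lambda>\<epsilon>. cover_nerve V (\<lambda>i. ?T \<epsilon> i \<inter> cball a r) = cover_nerve V (\<lambda>i. K i \<inter> cball a r)) (at_right 0)"
    "eventually (\<lambda>\<epsilon>. \<epsilon> > 0) (at_right (0::real))"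
    by (rule eventually_cover_nerve_thicken[OF V K(1)] eventually_at_right_less closed_UNIV closed_cball;
        assumption?)+
  then have "eventually (\<lambda>\<epsilon>. \<epsilon> > 0 \<and> cover_nerve V (?T \<epsilon>) = ?N \<and>
      cover_nerve V (\<lambda>i. ?T \<epsilon> i \<inter> cball a r) = cover_nerve V (\<lambda>i. K i \<inter> cball a r)) (at_right 0)"
    by eventually_elim simp
  then obtain \<epsilon> where \<epsilon>: "\<epsilon> > 0" "cover_nerve V (?T \<epsilon>) = ?N"
      "cover_nerve V (\<lambda>i. ?T \<epsilon> i \<inter> cball a r) = cover_nerve V (\<lambda>i. K i \<inter> cball a r)"
    using eventually_happens trivial_limit_at_right_real by blast
  (* T is the thickened family.  Its nerve and its trace on the target ball are those of K. *)
  define T where "T = ?T \<epsilon>"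
  have UT: "(\<Union>i\<in>V. T i) = ?P"
    unfolding T_def by (rule Union_thicken_outside[OF \<epsilon>(1)])
  have NT: "cover_nerve V T = ?N" using \<epsilon>(2) by (simp add: T_def)
  have KT: "K i \<subseteq> T i" if "i \<in> V" for i
    unfolding T_def using thicken_outside_superset[OF that \<epsilon>(1)] .
  have compact_P: "compact ?P" using V K by auto
  have compact_T: "compact (T i)" if "i \<in> V" for i
    using K that compact_P closed_thickening
    by (auto simp: T_def thicken_outside_def intro!: compact_Int_closed)
  have convex_T: "convex (T i)" if "i \<in> V" for i
    using K that P by (auto simp: T_def thicken_outside_def intro!: convex_Int convex_thickening)
  have reg_KT: "cover_region V K \<tau> \<subseteq> cover_region V T \<tau>" if "\<tau> \<subseteq> V" for \<tau>
    using KT that by (rule cover_region_mono)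
  have reg_\<sigma>: "cover_region V T \<sigma> = cover_region V K \<sigma>"
    unfolding cover_region_def UT by (auto simp: T_def thicken_outside_def)
  define p where "p = near \<sigma>"
  have p: "p \<in> cover_region V K \<sigma>" "dist a p = c" using near(1) \<sigma> by (auto simp: p_def m_def)
  have far: "c \<le> dist a y" if "y \<in> cover_region V K \<sigma>" for y
    using near(2)[OF \<sigma>(1) that] \<sigma>(2) by (simp add: m_def)
  have p_unique: "y = p" if "y \<in> cover_region V K \<sigma>" "dist a y \<le> c" for y
  proof (rule any_closest_point_unique[of "cover_region V K \<sigma>" _ _ a])
    show "convex (cover_region V K \<sigma>)"
      using convex_cover_region K P \<open>\<sigma> \<subseteq> V\<close> by blast
    show "closed (cover_region V K \<sigma>)"
      using compact_cover_region V K \<open>\<sigma> \<subseteq> V\<close> by (metis compact_imp_closed)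
  qed (use that p far in \<open>auto intro: order_trans\<close>)
  (* After thickening, a face not containing \<sigma> is lost strictly later: if its nearest point is at
     distance c, move a little towards a closer point of the region of \<tau> \<inter> \<sigma>, which exists by the
     minimality of \<sigma>.  Convexity keeps the point in the sets indexed by \<tau> \<inter> \<sigma>, and the thickening
     in the others. *)
  have T_near: "\<exists>y\<in>cover_region V T \<tau>. dist a y < c" if "\<tau> \<in> ?N" "\<not> \<sigma> \<subseteq> \<tau>" for \<tau>
  proof -
    have "\<tau> \<subseteq> V" using that by (simp add: cover_nerve_def)
    let ?x = "near \<tau>" and ?\<rho> = "\<tau> \<inter> \<sigma>"
    have x: "?x \<in> cover_region V K \<tau>" using near that by blast
    show ?thesis
    proof (cases "m \<tau> < c")
      case True
      then show ?thesis using x reg_KT[OF \<open>\<tau> \<subseteq> V\<close>] by (auto simp: m_def)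
    next
      case False
      then have mx: "dist a ?x = c" using m_le[OF that(1)] by (auto simp: m_def)
      have \<rho>: "?\<rho> \<in> ?N" "m ?\<rho> < c"
        using that m_less[of ?\<rho>] cover_nerve_downward[of \<tau> V K ?\<rho>] by auto
      define y where "y = near ?\<rho>"
      have y: "y \<in> cover_region V K ?\<rho>" "dist a y < c" using near \<rho> by (auto simp: y_def m_def)
      obtain t where t: "0 < t" "t \<le> 1" "dist ?x ((1 - t) *\<^sub>R ?x + t *\<^sub>R y) < \<epsilon>"
        using segment_near[OF \<epsilon>(1)] .
      let ?z = "(1 - t) *\<^sub>R ?x + t *\<^sub>R y"
      have "?x \<in> ?P" "y \<in> ?P" using x y by (auto simp: cover_region_def)
      then have zP: "?z \<in> ?P" using P t by (intro convexD_alt) auto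
      have "?z \<in> T i" if "i \<in> \<tau>" for i
      proof (cases "i \<in> \<sigma>")
        case True
        then have "?x \<in> K i" "y \<in> K i" using x y that by (auto simp: cover_region_def)
        then have "?z \<in> K i" using K(2) that \<open>\<tau> \<subseteq> V\<close> t by (intro convexD_alt) auto
        then show ?thesis using KT that \<open>\<tau> \<subseteq> V\<close> by blast
      next
        case False
        have "?x \<in> K i" using x that by (auto simp: cover_region_def)
        then have "?z \<in> thickening (K i) \<epsilon>" using t(3) by (auto simp: mem_thickening intro: less_imp_le)
        then show ?thesis using False zP by (simp add: T_def thicken_outside_def)
      qed
      then have "?z \<in> cover_region V T \<tau>"
        unfolding cover_region_def UT using zP by blast
      moreover have "dist a ?z < c"
        using segment_closer[of a y ?x t] y mx t by simp
      ultimately show ?thesis by blast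
    qed
  qed
  (* Conversely, the faces containing \<sigma> are all lost at radius c, and their nearest point is p. *)
  define F where "F = {i \<in> V. p \<in> T i}"
  have pT: "p \<in> cover_region V T \<sigma>" using p reg_\<sigma> by simp
  have "\<sigma> \<subseteq> F"
    using pT \<open>\<sigma> \<subseteq> V\<close> by (auto simp: F_def cover_region_def)
  have "p \<in> cover_region V T F"
    using pT by (auto simp: F_def cover_region_def)
  then have "F \<in> ?N"
    unfolding NT[symmetric] by (auto simp: cover_nerve_def F_def)
  have below_F: "\<tau> \<subseteq> F" if "\<tau> \<in> ?N" "\<sigma> \<subseteq> \<tau>" for \<tau>
  proof -
    have "\<tau> \<subseteq> V" using that by (simp add: cover_nerve_def)
    have "near \<tau> \<in> cover_region V K \<tau>" "dist a (near \<tau>) \<le> c"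
      using near that m_le by (auto simp: m_def)
    then have "near \<tau> = p" using cover_region_antimono[OF that(2), of V K] p_unique by blast
    then have "p \<in> cover_region V T \<tau>"
      using near(1)[OF that(1)] reg_KT[OF \<open>\<tau> \<subseteq> V\<close>] by auto
    then show ?thesis using \<open>\<tau> \<subseteq> V\<close> by (auto simp: F_def cover_region_def)
  qed
  have "F \<noteq> \<sigma>"
  proof
    assume "F = \<sigma>"
    (* The point p lies in the union, hence in some T i. *)
    have "\<sigma> \<noteq> {}"
      using pT by (auto simp: \<open>F = \<sigma>\<close>[symmetric] F_def cover_region_def)
    have "closed (\<Union>i\<in>V - \<sigma>. T i)"
      using V compact_T by (intro compact_imp_closed compact_UN) auto
    moreover have "p \<notin> (\<Union>i\<in>V - \<sigma>. T i)"
      by (auto simp: \<open>F = \<sigma>\<close>[symmetric] F_def)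
    ultimately obtain e where e: "e > 0" "ball p e \<inter> (\<Union>i\<in>V - \<sigma>. T i) = {}"
      by (metis closed_def openE ComplI disjoint_eq_subset_Compl)
    (* Near p the cover consists of the sets indexed by \<sigma> only. *)
    define Q where "Q = ?P \<inter> ball a c \<inter> ball p e"
    have "Q \<inter> (\<Inter>i\<in>\<sigma>. K i) \<noteq> {}"
    proof (rule convex_cover_intersection_convex)
      show "finite \<sigma>" "\<sigma> \<noteq> {}" using \<open>\<sigma> \<noteq> {}\<close> \<open>\<sigma> \<subseteq> V\<close> V finite_subset by auto
      show "convex Q" unfolding Q_def using P by (intro convex_Int convex_ball)
      show "closed (K i)" "convex (K i)" if "i \<in> \<sigma>" for i
        using K that \<open>\<sigma> \<subseteq> V\<close> by (auto intro: compact_imp_closed)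
      show "Q \<subseteq> (\<Union>i\<in>\<sigma>. K i)"
      proof
        fix x assume "x \<in> Q"
        then obtain i where "i \<in> V" "x \<in> K i" "x \<in> ball p e" by (auto simp: Q_def)
        then show "x \<in> (\<Union>i\<in>\<sigma>. K i)" using e(2) KT by blast
      qed
      show "Q \<inter> (\<Inter>j\<in>\<sigma> - {i}. K j) \<noteq> {}" if "i \<in> \<sigma>" for i
      proof -
        let ?\<rho> = "\<sigma> - {i}"
        have "?\<rho> \<in> ?N" "m ?\<rho> < c"
          using m_less[of ?\<rho>] cover_nerve_downward[OF \<sigma>(1), of ?\<rho>] that by auto
        define y where "y = near ?\<rho>"
        have y: "y \<in> cover_region V K ?\<rho>" "dist a y < c"
          using near \<open>?\<rho> \<in> ?N\<close> \<open>m ?\<rho> < c\<close> by (auto simp: y_def m_def)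
        obtain t where t: "0 < t" "t \<le> 1" "dist p ((1 - t) *\<^sub>R p + t *\<^sub>R y) < e"
          using segment_near[OF e(1)] .
        let ?z = "(1 - t) *\<^sub>R p + t *\<^sub>R y"
        have "p \<in> cover_region V K ?\<rho>" using p(1) cover_region_antimono[of ?\<rho> \<sigma> V K] by blast
        moreover have "convex (cover_region V K ?\<rho>)"
          using \<open>\<sigma> \<subseteq> V\<close> by (intro convex_cover_region K P) auto
        ultimately have "?z \<in> cover_region V K ?\<rho>"
          using y t by (intro convexD_alt) auto
        moreover have "dist a ?z < c"
          using segment_closer[of a y p t] y p t by simp
        ultimately have "?z \<in> Q \<inter> (\<Inter>j\<in>\<sigma> - {i}. K j)"
          using t by (auto simp: Q_def cover_region_def)
        then show ?thesis by blast
      qed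
    qed
    then obtain y where "y \<in> Q \<inter> (\<Inter>i\<in>\<sigma>. K i)" by blast
    then have "y \<in> cover_region V K \<sigma>" "dist a y < c"
      by (auto simp: Q_def cover_region_def)
    then show False using far[of y] by simp
  qed
  then have collapse: "elementary_collapse ?N (deletion ?N \<sigma>)"
    using elementary_collapse_interval[OF below_F \<sigma>(1) \<open>F \<in> ?N\<close>] \<open>\<sigma> \<subseteq> F\<close> by blast
  obtain witness where witness: "\<And>\<tau>. \<tau> \<in> deletion ?N \<sigma> \<Longrightarrow> witness \<tau> \<in> cover_region V T \<tau> \<and> dist a (witness \<tau>) < c"
    using T_near unfolding deletion_def by (metis (no_types, lifting) mem_Collect_eq)
  define c' where "c' = Max (insert r ((\<lambda>\<tau>. dist a (witness \<tau>)) ` deletion ?N \<sigma>))"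
  have fin: "finite (deletion ?N \<sigma>)" using finN by (auto simp: deletion_def)
  have "c' < c"
    unfolding c'_def using fin witness \<open>r < c\<close> by (subst Max_less_iff) auto
  have "r \<le> c'" unfolding c'_def using fin by simp
  have w_le: "dist a (witness \<tau>) \<le> c'" if "\<tau> \<in> deletion ?N \<sigma>" for \<tau>
    unfolding c'_def using fin that by simp
  define K' where "K' i = T i \<inter> cball a c'" for i
  have "cover_nerve V K' = deletion ?N \<sigma>"
  proof
    show "cover_nerve V K' \<subseteq> deletion ?N \<sigma>"
    proof
      fix \<tau> assume "\<tau> \<in> cover_nerve V K'"
      then obtain x where x: "\<tau> \<subseteq> V" "x \<in> cover_region V T \<tau>" "dist a x \<le> c'"
        unfolding K'_def by (auto simp: cover_nerve_def cover_region_Int)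
      then have "\<tau> \<in> ?N" unfolding NT[symmetric] by (auto simp: cover_nerve_def)
      moreover have "\<not> \<sigma> \<subseteq> \<tau>"
        using cover_region_antimono[of \<sigma> \<tau> V T] reg_\<sigma> far x \<open>c' < c\<close> by fastforce
      ultimately show "\<tau> \<in> deletion ?N \<sigma>" by (simp add: deletion_def)
    qed
    show "deletion ?N \<sigma> \<subseteq> cover_nerve V K'"
    proof
      fix \<tau> assume \<tau>: "\<tau> \<in> deletion ?N \<sigma>"
      then have "\<tau> \<subseteq> V" by (simp add: deletion_def cover_nerve_def)
      moreover have "witness \<tau> \<in> cover_region V T \<tau> \<inter> cball a c'"
        using witness[OF \<tau>] w_le[OF \<tau>] by simp
      ultimately show "\<tau> \<in> cover_nerve V K'"
        unfolding K'_def cover_nerve_def cover_region_Int by blast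
    qed
  qed
  moreover have "K' i \<inter> cball a r = ?T \<epsilon> i \<inter> cball a r" for i
    using \<open>r \<le> c'\<close> by (auto simp: K'_def T_def)
  moreover have "(\<Union>i\<in>V. K' i) = ?P \<inter> cball a c'"
    using UT by (auto simp: K'_def)
  moreover have "compact (K' i)" "convex (K' i)" if "i \<in> V" for i
    unfolding K'_def using that compact_T convex_T by (simp_all add: compact_Int_closed convex_Int)
  ultimately show ?thesis
    using that[of K'] collapse \<epsilon>(3) P by (simp add: convex_Int)
qed

text \<open>
  Each step of the sweep removes at least one face, so the claim follows by induction on the number
  of faces.
\<close>

theorem cover_nerve_collapses_onto_cball:
  fixes K :: "'v \<Rightarrow> 'a::real_inner set" and a :: 'a
  assumes "finite V" "\<And>i. i \<in> V \<Longrightarrow> compact (K i)" "\<And>i. i \<in> V \<Longrightarrow> convex (K i)"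
    "convex (\<Union>i\<in>V. K i)"
  shows "collapses_onto (cover_nerve V K) (cover_nerve V (\<lambda>i. K i \<inter> cball a r))"
  using assms
proof (induction "card (cover_nerve V K)" arbitrary: K rule: less_induct)
  case less
  show ?case
  proof (cases "cover_nerve V K = cover_nerve V (\<lambda>i. K i \<inter> cball a r)")
    case True
    then show ?thesis by (simp add: collapses_onto_def)
  next
    case False
    obtain K' where K': "\<And>i. i \<in> V \<Longrightarrow> compact (K' i)" "\<And>i. i \<in> V \<Longrightarrow> convex (K' i)"
      "convex (\<Union>i\<in>V. K' i)" and step: "elementary_collapse (cover_nerve V K) (cover_nerve V K')"
      and eq: "cover_nerve V (\<lambda>i. K' i \<inter> cball a r) = cover_nerve V (\<lambda>i. K i \<inter> cball a r)"
      using sweep_step[OF less.prems False] by metis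
    have "finite (cover_nerve V K)" using less.prems(1) by (simp add: cover_nerve_def)
    moreover have "cover_nerve V K' \<subset> cover_nerve V K"
      using step by (auto simp: elementary_collapse_def free_face_def deletion_def)
    ultimately have "collapses_onto (cover_nerve V K') (cover_nerve V (\<lambda>i. K' i \<inter> cball a r))"
      using less.prems(1) K' by (intro less.hyps) (auto intro: psubset_card_mono)
    then show ?thesis
      using step unfolding eq collapses_onto_def by (rule converse_rtranclp_into_rtranclp[rotated])
  qed
qed

section \<open>From compact sets and balls to open sets and half-spaces\<close>

lemma closed_ball_subset: "closed {x :: 'a::metric_space. ball x \<delta> \<subseteq> U}"
proof -
  have "{x. ball x \<delta> \<subseteq> U} = (\<Inter>w\<in>- U. {x. \<delta> \<le> dist x w})"
  proof (intro set_eqI iffI)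
    fix x assume x: "x \<in> {x. ball x \<delta> \<subseteq> U}"
    have "\<delta> \<le> dist x w" if "w \<in> - U" for w
    proof (rule leI)
      show "\<not> dist x w < \<delta>" using x that by auto
    qed
    then show "x \<in> (\<Inter>w\<in>- U. {x. \<delta> \<le> dist x w})" by simp
  next
    fix x assume x: "x \<in> (\<Inter>w\<in>- U. {x. \<delta> \<le> dist x w})"
    have "w \<in> U" if "dist x w < \<delta>" for w
    proof (rule ccontr)
      assume "w \<notin> U"
      then have "\<delta> \<le> dist x w" using INT_D[OF x, of w] by simp
      then show False using that by simp
    qed
    then show "x \<in> {x. ball x \<delta> \<subseteq> U}" by auto
  qed
  moreover have "closed {x. \<delta> \<le> dist x w}" for w :: 'a
    by (intro closed_Collect_le continuous_intros)
  ultimately show ?thesis by (metis closed_INT)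
qed

lemma convex_ball_subset:
  assumes "convex U"
  shows "convex {x :: 'a::real_normed_vector. ball x \<delta> \<subseteq> U}"
proof (rule convexI, safe)
  fix x y :: 'a and u v :: real and w
  assume *: "ball x \<delta> \<subseteq> U" "ball y \<delta> \<subseteq> U" "0 \<le> u" "0 \<le> v" "u + v = 1" "w \<in> ball (u *\<^sub>R x + v *\<^sub>R y) \<delta>"
  define d where "d = w - (u *\<^sub>R x + v *\<^sub>R y)"
  have "norm d < \<delta>"
    using *(6) by (simp add: d_def dist_norm norm_minus_commute)
  then have "x + d \<in> ball x \<delta>" "y + d \<in> ball y \<delta>"
    by (simp_all add: dist_norm)
  then have "x + d \<in> U" "y + d \<in> U"
    using *(1,2) by blast+
  then have "u *\<^sub>R (x + d) + v *\<^sub>R (y + d) \<in> U"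
    using *(3-5) by (intro convexD[OF assms])
  also have "u *\<^sub>R (x + d) + v *\<^sub>R (y + d) = u *\<^sub>R x + v *\<^sub>R y + (u + v) *\<^sub>R d"
    by (simp add: algebra_simps)
  also have "\<dots> = w"
    unfolding *(5) by (simp add: d_def)
  finally show "w \<in> U" .
qed

text \<open>
  Compact convex sets inside the open sets that still have convex union and contain prescribed
  points.  Let \<open>S\<close> be the convex hull of these points, and \<open>\<epsilon>\<close> a Lebesgue number of the cover of \<open>S\<close>
  that also serves each of the points.  The set of centres of the \<open>\<epsilon>\<close>-balls inside \<open>U i\<close> is
  closed and convex, and by the choice of \<open>\<epsilon>\<close> these sets cover \<open>S\<close>.
\<close>

lemma compact_shrinking:
  fixes U :: "'v \<Rightarrow> 'a::real_normed_vector set"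
  assumes V: "finite V" and U: "\<And>i. i \<in> V \<Longrightarrow> open (U i)" "\<And>i. i \<in> V \<Longrightarrow> convex (U i)"
    and P: "convex (\<Union>i\<in>V. U i)" and X: "finite X" "X \<subseteq> (\<Union>i\<in>V. U i)"
  obtains K where "\<And>i. i \<in> V \<Longrightarrow> compact (K i)" "\<And>i. i \<in> V \<Longrightarrow> convex (K i)"
    "convex (\<Union>i\<in>V. K i)" "\<And>i. i \<in> V \<Longrightarrow> K i \<subseteq> U i" "\<And>i. i \<in> V \<Longrightarrow> X \<inter> U i \<subseteq> K i"
proof -
  define S where "S = convex hull X"
  have S: "compact S" "convex S" "X \<subseteq> S" "S \<subseteq> (\<Union>i\<in>V. U i)"
    unfolding S_def using X P by (simp_all add: finite_imp_compact_convex_hull hull_subset hull_minimal)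
  obtain \<delta> where \<delta>: "0 < \<delta>" "\<And>x. x \<in> S \<Longrightarrow> \<exists>G\<in>U ` V. ball x \<delta> \<subseteq> G"
    using Heine_Borel_lemma[OF S(1), of "U ` V"] S(4) U(1) by blast
  have "\<exists>\<eta>>0. ball x \<eta> \<subseteq> U i" if "i \<in> V" "x \<in> U i" for i x
    using U(1) that openE by metis
  then obtain \<eta> where \<eta>: "\<And>i x. i \<in> V \<Longrightarrow> x \<in> U i \<Longrightarrow> \<eta> i x > 0 \<and> ball x (\<eta> i x) \<subseteq> U i"
    by metis
  define J where "J = {(i, x). i \<in> V \<and> x \<in> X \<inter> U i}"
  have "finite J"
    by (rule finite_subset[of _ "V \<times> X"]) (use V X in \<open>auto simp: J_def\<close>)
  define \<epsilon> where "\<epsilon> = Min (insert \<delta> ((\<lambda>(i, x). \<eta> i x) ` J))"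
  have "\<epsilon> > 0" "\<epsilon> \<le> \<delta>"
    unfolding \<epsilon>_def using \<open>finite J\<close> \<eta> \<delta>(1) by (auto simp: J_def)
  have "\<epsilon> \<le> \<eta> i x" if "i \<in> V" "x \<in> X \<inter> U i" for i x
    unfolding \<epsilon>_def using \<open>finite J\<close> that by (intro Min_le) (auto simp: J_def)
  then have ball_X: "ball x \<epsilon> \<subseteq> U i" if "i \<in> V" "x \<in> X \<inter> U i" for i x
    using \<eta> that by (meson Int_iff subset_ball subset_trans)
  define K where "K i = S \<inter> {x. ball x \<epsilon> \<subseteq> U i}" for i
  have "(\<Union>i\<in>V. K i) = S"
    using \<delta>(2) \<open>\<epsilon> \<le> \<delta>\<close> subset_ball unfolding K_def by fastforce
  moreover have "compact (K i)" "convex (K i)" "K i \<subseteq> U i" "X \<inter> U i \<subseteq> K i" if "i \<in> V" for i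
  proof -
    show "compact (K i)" "convex (K i)"
      unfolding K_def using S U that
      by (auto intro!: compact_Int_closed closed_ball_subset convex_Int convex_ball_subset)
    show "K i \<subseteq> U i"
      unfolding K_def using centre_in_ball \<open>\<epsilon> > 0\<close> by blast
    show "X \<inter> U i \<subseteq> K i"
      unfolding K_def using S(3) ball_X[OF that] by blast
  qed
  ultimately show ?thesis
    using that[of K] S(2) by simp
qed

text \<open>
  The ball is tangent to the hyperplane \<open>inner \<nu> x = b\<close> at \<open>x0\<close>.  In this form of the membership
  condition it is apparent that the ball lies in the closed half-space and that it swallows any given
  point of the open half-space when \<open>t\<close> is large.
\<close>

lemma mem_tangent_cball:
  fixes \<nu> :: "'a::real_inner"
  assumes "\<nu> \<noteq> 0" "t \<ge> 0" and x0: "inner \<nu> x0 = b"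
  shows "x \<in> cball (x0 + t *\<^sub>R \<nu>) (t * norm \<nu>) \<longleftrightarrow> (norm (x - x0))\<^sup>2 \<le> 2 * t * (inner \<nu> x - b)"
proof -
  have "x \<in> cball (x0 + t *\<^sub>R \<nu>) (t * norm \<nu>) \<longleftrightarrow> norm ((x - x0) - t *\<^sub>R \<nu>) \<le> t * norm \<nu>"
    by (simp add: dist_norm norm_minus_commute algebra_simps)
  also have "\<dots> \<longleftrightarrow> (norm ((x - x0) - t *\<^sub>R \<nu>))\<^sup>2 \<le> (t * norm \<nu>)\<^sup>2"
    using assms by (simp add: power2_le_iff_abs_le)
  also have "(norm ((x - x0) - t *\<^sub>R \<nu>))\<^sup>2 = (norm (x - x0))\<^sup>2 - 2 * t * (inner \<nu> x - b) + (t * norm \<nu>)\<^sup>2"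
    unfolding power_mult_distrib power2_norm_eq_inner
    by (simp add: inner_simps x0 inner_commute power2_eq_square algebra_simps)
  finally show ?thesis by simp
qed

lemma open_perturb:
  fixes W :: "'a::real_normed_vector set"
  assumes "open W" "x \<in> W"
  shows "\<exists>t>0. x + t *\<^sub>R \<nu> \<in> W"
proof -
  obtain e where e: "e > 0" "ball x e \<subseteq> W" using assms openE by blast
  have pos: "norm \<nu> + 1 > 0" by (simp add: add_nonneg_pos)
  define t where "t = e / (norm \<nu> + 1)"
  have "t > 0" using e pos by (simp add: t_def)
  moreover have "t * norm \<nu> < e"
    using e pos by (simp add: t_def divide_simps)
  ultimately show ?thesis
    using e(2) by (intro exI[of _ t]) (auto simp: dist_norm)
qed

text \<open>
  The shrunk sets contain one witness for every face of either nerve, and the tangent ball contains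
  the witnesses for the half-space; so neither nerve loses a face.  The ball only lies in the
  closed half-space, but since the \<open>U i\<close> are open, the closed half-space gives no further faces.
\<close>

theorem cover_nerve_collapses_onto_halfspace_inner:
  fixes U :: "'v \<Rightarrow> 'a::real_inner set" and \<nu> :: 'a
  assumes V: "finite V" and U: "\<And>i. i \<in> V \<Longrightarrow> open (U i)" "\<And>i. i \<in> V \<Longrightarrow> convex (U i)"
    and P: "convex (\<Union>i\<in>V. U i)" and "\<nu> \<noteq> 0"
  shows "collapses_onto (cover_nerve V U) (cover_nerve V (\<lambda>i. U i \<inter> {x. b < inner \<nu> x}))"
proof -
  let ?H = "{x. b < inner \<nu> x}"
  let ?N = "cover_nerve V U" and ?M = "cover_nerve V (\<lambda>i. U i \<inter> ?H)"
  obtain x where x: "\<And>\<tau>. \<tau> \<in> ?N \<Longrightarrow> x \<tau> \<in> cover_region V U \<tau>"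
    using that[of "\<lambda>\<tau>. SOME y. y \<in> cover_region V U \<tau>"] by (simp add: cover_nerve_def some_in_eq)
  obtain z where z: "\<And>\<tau>. \<tau> \<in> ?M \<Longrightarrow> z \<tau> \<in> cover_region V U \<tau> \<inter> ?H"
    using that[of "\<lambda>\<tau>. SOME y. y \<in> cover_region V U \<tau> \<inter> ?H"]
    by (simp add: cover_nerve_def cover_region_Int some_in_eq del: Int_iff)
  have fin: "finite ?N" "finite ?M" using V by (auto simp: cover_nerve_def)
  define X where "X = x ` ?N \<union> z ` ?M"
  have "finite X" using fin by (simp add: X_def)
  moreover have "X \<subseteq> (\<Union>i\<in>V. U i)"
    using x z by (fastforce simp: X_def cover_region_def)
  ultimately obtain K where K: "\<And>i. i \<in> V \<Longrightarrow> compact (K i)" "\<And>i. i \<in> V \<Longrightarrow> convex (K i)"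
    "convex (\<Union>i\<in>V. K i)" "\<And>i. i \<in> V \<Longrightarrow> K i \<subseteq> U i" "\<And>i. i \<in> V \<Longrightarrow> X \<inter> U i \<subseteq> K i"
    using compact_shrinking[OF V U P] by metis
  have X_region: "y \<in> cover_region V K \<tau>" if "y \<in> X" "y \<in> cover_region V U \<tau>" "\<tau> \<subseteq> V" for y \<tau>
    using that K(5) unfolding cover_region_def by blast
  have "?N \<subseteq> cover_nerve V K"
  proof
    fix \<tau> assume "\<tau> \<in> ?N"
    then have "\<tau> \<subseteq> V" "x \<tau> \<in> cover_region V K \<tau>"
      using x[of \<tau>] X_region[of "x \<tau>" \<tau>] by (auto simp: X_def cover_nerve_def)
    then show "\<tau> \<in> cover_nerve V K" by (auto simp: cover_nerve_def)
  qed
  then have NK: "cover_nerve V K = ?N"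
    using cover_nerve_mono[of V K U] K(4) by blast
  define x0 where "x0 = (b / inner \<nu> \<nu>) *\<^sub>R \<nu>"
  have x0: "inner \<nu> x0 = b" using \<open>\<nu> \<noteq> 0\<close> by (simp add: x0_def)
  (* By mem_tangent_cball, each quotient is the value of t from which on the ball contains the witness. *)
  define t where "t = Max (insert 0 ((\<lambda>\<tau>. (norm (z \<tau> - x0))\<^sup>2 / (2 * (inner \<nu> (z \<tau>) - b))) ` ?M))"
  have "t \<ge> 0" unfolding t_def using fin by simp
  let ?B = "cball (x0 + t *\<^sub>R \<nu>) (t * norm \<nu>)"
  note mem_B = mem_tangent_cball[OF \<open>\<nu> \<noteq> 0\<close> \<open>t \<ge> 0\<close> x0]
  have z_B: "z \<tau> \<in> ?B" if "\<tau> \<in> ?M" for \<tau>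
  proof -
    have "(norm (z \<tau> - x0))\<^sup>2 / (2 * (inner \<nu> (z \<tau>) - b)) \<le> t"
      unfolding t_def using fin that by (intro Max_ge) auto
    moreover have "inner \<nu> (z \<tau>) - b > 0" using z[OF that] by simp
    ultimately show ?thesis unfolding mem_B by (simp add: divide_simps mult_ac)
  qed
  have B_ge: "b \<le> inner \<nu> y" if "y \<in> ?B" for y
  proof -
    have *: "(norm (y - x0))\<^sup>2 \<le> 2 * t * (inner \<nu> y - b)"
      using that by (simp only: mem_B)
    have "0 \<le> 2 * t * (inner \<nu> y - b)"
      by (rule order_trans[OF zero_le_power2 *])
    moreover have "t = 0 \<longrightarrow> y = x0"
      using * by auto
    ultimately show ?thesis using \<open>t \<ge> 0\<close> x0 by (auto simp: zero_le_mult_iff)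
  qed
  have "cover_nerve V (\<lambda>i. K i \<inter> ?B) = ?M"
  proof
    show "cover_nerve V (\<lambda>i. K i \<inter> ?B) \<subseteq> ?M"
    proof
      fix \<tau> assume "\<tau> \<in> cover_nerve V (\<lambda>i. K i \<inter> ?B)"
      then obtain y where y: "\<tau> \<subseteq> V" "y \<in> cover_region V K \<tau>" "y \<in> ?B"
        unfolding cover_nerve_def cover_region_Int by blast
      have "cover_region V K \<tau> \<subseteq> cover_region V U \<tau>"
        using K(4) y(1) by (rule cover_region_mono)
      then have "y \<in> cover_region V U \<tau>"
        using y(2) by (rule subsetD)
      moreover have "open (cover_region V U \<tau>)"
        using V open_openin[THEN iffD1, OF U(1)] y(1)
        by (intro open_openin[THEN iffD2] openin_cover_region)
      ultimately obtain s where "s > 0" "y + s *\<^sub>R \<nu> \<in> cover_region V U \<tau>"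
        using open_perturb[of "cover_region V U \<tau>" y \<nu>] by blast
      moreover have "b < inner \<nu> (y + s *\<^sub>R \<nu>)"
      proof -
        have "s * inner \<nu> \<nu> > 0" using \<open>s > 0\<close> \<open>\<nu> \<noteq> 0\<close> by simp
        then show ?thesis using B_ge[OF y(3)] by (simp add: inner_add_right)
      qed
      ultimately show "\<tau> \<in> ?M"
        using y(1) by (auto simp: cover_nerve_def cover_region_Int)
    qed
    show "?M \<subseteq> cover_nerve V (\<lambda>i. K i \<inter> ?B)"
    proof
      fix \<tau> assume \<tau>: "\<tau> \<in> ?M"
      then have "\<tau> \<subseteq> V" by (simp add: cover_nerve_def)
      then have "z \<tau> \<in> cover_region V K \<tau>"
        using X_region[of "z \<tau>" \<tau>] z[OF \<tau>] \<tau> by (auto simp: X_def)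
      then show "\<tau> \<in> cover_nerve V (\<lambda>i. K i \<inter> ?B)"
        using z_B[OF \<tau>] \<open>\<tau> \<subseteq> V\<close> by (auto simp: cover_nerve_def cover_region_Int simp del: mem_cball)
    qed
  qed
  then show ?thesis
    using cover_nerve_collapses_onto_cball[OF V K(1-3), of "x0 + t *\<^sub>R \<nu>" "t * norm \<nu>"] NK by simp
qed

section \<open>A real inner product space containing all Euclidean spaces\<close>

text \<open>
  The dimension \<open>d\<close> is a term, whereas the geometric results above are about types.  The finitely
  supported sequences form one inner product space that projects onto every \<open>\<real>\<^sup>d\<close>, and the preimages
  of a cover of \<open>\<real>\<^sup>d\<close> form a cover with the same nerve.
\<close>

instantiation poly_mapping :: (type, real_inner) real_inner
begin

lift_definition scaleR_poly_mapping :: "real \<Rightarrow> ('a \<Rightarrow>\<^sub>0 'b) \<Rightarrow> ('a \<Rightarrow>\<^sub>0 'b)"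
  is "\<lambda>r f k. r *\<^sub>R f k"
  by (erule finite_subset[rotated]) auto

definition inner_poly_mapping :: "('a \<Rightarrow>\<^sub>0 'b) \<Rightarrow> ('a \<Rightarrow>\<^sub>0 'b) \<Rightarrow> real"
  where "inner_poly_mapping f g = (\<Sum>k\<in>Poly_Mapping.keys f. inner (Poly_Mapping.lookup f k) (Poly_Mapping.lookup g k))"

definition norm_poly_mapping :: "('a \<Rightarrow>\<^sub>0 'b) \<Rightarrow> real"
  where "norm_poly_mapping f = sqrt (inner f f)"

definition dist_poly_mapping :: "('a \<Rightarrow>\<^sub>0 'b) \<Rightarrow> ('a \<Rightarrow>\<^sub>0 'b) \<Rightarrow> real"
  where "dist_poly_mapping f g = norm (f - g)"

definition sgn_poly_mapping :: "('a \<Rightarrow>\<^sub>0 'b) \<Rightarrow> ('a \<Rightarrow>\<^sub>0 'b)"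
  where "sgn_poly_mapping f = inverse (norm f) *\<^sub>R f"

definition uniformity_poly_mapping :: "(('a \<Rightarrow>\<^sub>0 'b) \<times> ('a \<Rightarrow>\<^sub>0 'b)) filter"
  where "uniformity_poly_mapping = (INF e\<in>{0<..}. principal {(x, y). dist x y < e})"

definition open_poly_mapping :: "('a \<Rightarrow>\<^sub>0 'b) set \<Rightarrow> bool"
  where "open_poly_mapping S \<longleftrightarrow> (\<forall>x\<in>S. eventually (\<lambda>(x', y). x' = x \<longrightarrow> y \<in> S) uniformity)"

lemma lookup_scaleR: "Poly_Mapping.lookup (r *\<^sub>R f) k = r *\<^sub>R Poly_Mapping.lookup f k"
  by (simp add: scaleR_poly_mapping.rep_eq)

lemma inner_poly_mapping_eq_sum:
  assumes "finite A" "Poly_Mapping.keys f \<subseteq> A"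
  shows "inner f g = (\<Sum>k\<in>A. inner (Poly_Mapping.lookup f k) (Poly_Mapping.lookup g k))"
  unfolding inner_poly_mapping_def
  by (rule sum.mono_neutral_left) (use assms in \<open>auto simp: in_keys_iff\<close>)

instance
proof
  fix f g h :: "'a \<Rightarrow>\<^sub>0 'b" and r s :: real
  show "r *\<^sub>R (f + g) = r *\<^sub>R f + r *\<^sub>R g" "(r + s) *\<^sub>R f = r *\<^sub>R f + s *\<^sub>R f"
    "r *\<^sub>R s *\<^sub>R f = (r * s) *\<^sub>R f" "1 *\<^sub>R f = f"
    by (auto intro!: poly_mapping_eqI simp: lookup_scaleR lookup_add algebra_simps)
  show "inner f g = inner g f"
    using inner_poly_mapping_eq_sum[of "Poly_Mapping.keys f \<union> Poly_Mapping.keys g" f g]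
      inner_poly_mapping_eq_sum[of "Poly_Mapping.keys f \<union> Poly_Mapping.keys g" g f] by (simp add: inner_commute)
  show "inner (f + g) h = inner f h + inner g h"
    using inner_poly_mapping_eq_sum[of "Poly_Mapping.keys f \<union> Poly_Mapping.keys g" f h]
      inner_poly_mapping_eq_sum[of "Poly_Mapping.keys f \<union> Poly_Mapping.keys g" g h]
      inner_poly_mapping_eq_sum[of "Poly_Mapping.keys f \<union> Poly_Mapping.keys g" "f + g" h] keys_add[of f g]
    by (simp add: lookup_add inner_add_left sum.distrib)
  have "Poly_Mapping.keys (r *\<^sub>R f) \<subseteq> Poly_Mapping.keys f" by (auto simp: in_keys_iff lookup_scaleR)
  then show "inner (r *\<^sub>R f) g = r * inner f g"
    using inner_poly_mapping_eq_sum[of "Poly_Mapping.keys f" "r *\<^sub>R f" g]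
    by (simp add: inner_poly_mapping_def lookup_scaleR sum_distrib_left)
  show "0 \<le> inner f f"
    by (simp add: inner_poly_mapping_def sum_nonneg)
  show "inner f f = 0 \<longleftrightarrow> f = 0"
  proof
    assume "inner f f = 0"
    then have "\<forall>k\<in>Poly_Mapping.keys f. inner (Poly_Mapping.lookup f k) (Poly_Mapping.lookup f k) = 0"
      unfolding inner_poly_mapping_def by (subst (asm) sum_nonneg_eq_0_iff) auto
    then show "f = 0" by (intro poly_mapping_eqI) (auto simp: in_keys_iff)
  qed (simp add: inner_poly_mapping_def)
qed (simp_all add: norm_poly_mapping_def dist_poly_mapping_def sgn_poly_mapping_def
      uniformity_poly_mapping_def open_poly_mapping_def)

end

section \<open>Transfer to Euclidean spaces\<close>

definition dotp :: "nat \<Rightarrow> (nat \<Rightarrow> real) \<Rightarrow> (nat \<Rightarrow> real) \<Rightarrow> real"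
  where "dotp d \<nu> x = (\<Sum>i<d. \<nu> i * x i)"

lemma linear_dotp: "linear (dotp d \<nu>)"
  by (rule linearI) (simp_all add: dotp_def algebra_simps sum.distrib sum_distrib_left)

lemma dotp_commute: "dotp d x y = dotp d y x"
  by (simp add: dotp_def mult.commute)

lemma dotp_uminus_left: "dotp d (- \<nu>) x = - dotp d \<nu> x"
  by (simp add: dotp_def sum_negf)

lemma continuous_on_dotp: "continuous_on A (dotp d \<nu>)" "continuous_on A (\<lambda>x. dotp d x \<nu>)" "continuous_on A (\<lambda>x. dotp d x x)"
  unfolding dotp_def
  by (intro continuous_intros continuous_on_subset[OF continuous_on_product_coordinates subset_UNIV])+

lemma dotp_pos: "i < d \<Longrightarrow> x i \<noteq> 0 \<Longrightarrow> 0 < dotp d x x"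
  unfolding dotp_def by (rule sum_pos2[of _ i]) (auto simp: zero_less_mult_iff not_less_iff_gr_or_eq)

definition emb :: "nat \<Rightarrow> (nat \<Rightarrow> real) \<Rightarrow> nat \<Rightarrow>\<^sub>0 real"
  where "emb d x = (\<Sum>i<d. Poly_Mapping.single i (x i))"

definition proj :: "nat \<Rightarrow> (nat \<Rightarrow>\<^sub>0 real) \<Rightarrow> nat \<Rightarrow> real"
  where "proj d v = (\<lambda>i. if i < d then Poly_Mapping.lookup v i else 0)"

lemma lookup_emb: "Poly_Mapping.lookup (emb d x) i = (if i < d then x i else 0)"
  by (simp add: emb_def lookup_sum lookup_single when_def)

lemma proj_emb: "x \<in> topspace (Euclidean_space d) \<Longrightarrow> proj d (emb d x) = x"
  by (auto simp: proj_def lookup_emb fun_eq_iff topspace_Euclidean_space)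

lemma linear_proj: "linear (proj d)"
  by (rule linearI) (auto simp: proj_def fun_eq_iff lookup_add lookup_scaleR)

lemma linear_emb: "linear (emb d)"
  by (rule linearI) (auto intro!: poly_mapping_eqI simp: lookup_emb lookup_add lookup_scaleR)

lemma inner_emb: "inner (emb d \<nu>) v = dotp d \<nu> (proj d v)"
proof -
  have "Poly_Mapping.keys (emb d \<nu>) \<subseteq> {..<d}"
    by (auto simp: in_keys_iff lookup_emb split: if_splits)
  then show ?thesis
    by (simp add: inner_poly_mapping_eq_sum[of "{..<d}"] dotp_def proj_def lookup_emb)
qed

lemma lookup_eq_inner: "Poly_Mapping.lookup v i = inner (Poly_Mapping.single i 1) (v :: 'k \<Rightarrow>\<^sub>0 real)"
  by (simp add: inner_poly_mapping_def)

lemma continuous_map_proj: "continuous_map euclidean (Euclidean_space d) (proj d)"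
  unfolding proj_def continuous_map_componentwise_Euclidean_space lookup_eq_inner
  by (auto intro!: continuous_intros)

lemma open_vimage_proj:
  assumes "openin (Euclidean_space d) U"
  shows "open (proj d -` U)"
  using openin_continuous_map_preimage[OF continuous_map_proj assms]
  by (simp add: vimage_def)

lemma openin_Euclidean_space_perturb:
  assumes W: "openin (Euclidean_space d) W" and x: "x \<in> W" and \<nu>: "\<nu> \<in> topspace (Euclidean_space d)"
  shows "\<exists>t>0. x + t *\<^sub>R \<nu> \<in> W"
proof -
  have xd: "x \<in> topspace (Euclidean_space d)"
    using openin_subset[OF W] x by blast
  have "emb d x \<in> proj d -` W"
    using x proj_emb[OF xd] by simp
  from open_perturb[OF open_vimage_proj[OF W] this, of "emb d \<nu>"]
  obtain t where "t > 0" "emb d x + t *\<^sub>R emb d \<nu> \<in> proj d -` W" by blast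
  moreover have "proj d (emb d x + t *\<^sub>R emb d \<nu>) = x + t *\<^sub>R \<nu>"
    using proj_emb[OF xd] proj_emb[OF \<nu>] by (simp add: linear_add[OF linear_proj] linear_scale[OF linear_proj])
  ultimately show ?thesis by auto
qed

text \<open>
  The half-space with normal \<open>\<nu>\<close> in \<open>\<real>\<^sup>d\<close> pulls back to the half-space with normal \<open>emb d \<nu>\<close>, and
  pulling back along the projection preserves openness, convexity and nerves.
\<close>

theorem cover_nerve_collapses_onto_halfspace:
  assumes V: "finite V" and U: "\<And>i. i \<in> V \<Longrightarrow> openin (Euclidean_space d) (U i)" "\<And>i. i \<in> V \<Longrightarrow> convex (U i)"
    and P: "convex (\<Union>i\<in>V. U i)" and \<nu>: "k < d" "\<nu> k \<noteq> 0"
  shows "collapses_onto (cover_nerve V U) (cover_nerve V (\<lambda>i. U i \<inter> {x. b < dotp d \<nu> x}))"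
proof -
  let ?H = "{x. b < dotp d \<nu> x}"
  have P_sub: "(\<Union>i\<in>V. U i) \<subseteq> range (proj d)"
    using openin_subset[OF U(1)] proj_emb by (metis UN_least rangeI subset_iff)
  have "collapses_onto (cover_nerve V (\<lambda>i. proj d -` U i))
      (cover_nerve V (\<lambda>i. proj d -` U i \<inter> {v. b < inner (emb d \<nu>) v}))"
  proof (rule cover_nerve_collapses_onto_halfspace_inner[OF V])
    show "open (proj d -` U i)" "convex (proj d -` U i)" if "i \<in> V" for i
      using open_vimage_proj[OF U(1)[OF that]] convex_linear_vimage[OF linear_proj U(2)[OF that]] .
    show "convex (\<Union>i\<in>V. proj d -` U i)"
      using convex_linear_vimage[OF linear_proj P] by (simp add: vimage_UN)
    show "emb d \<nu> \<noteq> 0"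
      using lookup_emb[of d \<nu> k] \<nu> by auto
  qed
  moreover have "proj d -` U i \<inter> {v. b < inner (emb d \<nu>) v} = proj d -` (U i \<inter> ?H)" for i
    by (auto simp: inner_emb)
  moreover have "cover_nerve V (\<lambda>i. proj d -` U i) = cover_nerve V U"
    using P_sub by (rule cover_nerve_vimage)
  moreover have "cover_nerve V (\<lambda>i. proj d -` (U i \<inter> ?H)) = cover_nerve V (\<lambda>i. U i \<inter> ?H)"
    using P_sub by (intro cover_nerve_vimage) blast
  ultimately show ?thesis by simp
qed

section \<open>Separating hyperplanes in Euclidean spaces\<close>

lemma compact_Euclidean_sphere: "compact {\<nu> \<in> topspace (Euclidean_space d). dotp d \<nu> \<nu> = 1}" (is "compact ?T")
proof -
  let ?B = "PiE UNIV (\<lambda>_. {-1..1}) :: (nat \<Rightarrow> real) set"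
  have "compactin (powertop_real UNIV) ?B"
    by (simp add: compactin_PiE)
  then have "compact ?B"
    by (simp add: euclidean_product_topology)
  moreover have "closed ({\<nu>. dotp d \<nu> \<nu> = 1} \<inter> topspace (Euclidean_space d))"
    by (intro closed_Int closed_Collect_eq continuous_on_dotp continuous_on_const
        closedin_Euclidean_imp_closed[of d] closedin_topspace)
  ultimately have "compact (?B \<inter> ({\<nu>. dotp d \<nu> \<nu> = 1} \<inter> topspace (Euclidean_space d)))"
    by (rule compact_Int_closed)
  moreover have "\<nu> \<in> ?B" if "\<nu> \<in> ?T" for \<nu>
  proof -
    have "\<bar>\<nu> i\<bar> \<le> 1" for i
    proof (cases "i < d")
      case True
      have "\<nu> i * \<nu> i \<le> dotp d \<nu> \<nu>"
        unfolding dotp_def using True by (intro member_le_sum) auto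
      then show ?thesis
        using that by (simp add: abs_le_square_iff[of _ 1, simplified] power2_eq_square)
    qed (use that in \<open>simp add: topspace_Euclidean_space\<close>)
    then show ?thesis by (auto simp: abs_le_iff minus_le_iff)
  qed
  then have "?B \<inter> ({\<nu>. dotp d \<nu> \<nu> = 1} \<inter> topspace (Euclidean_space d)) = ?T" by blast
  ultimately show ?thesis by simp
qed

text \<open>
  A suitable normal is the normalised point of the convex hull nearest to the origin.
\<close>

lemma finite_half_space_normal:
  assumes Z: "finite Z" "Z \<noteq> {}" "Z \<subseteq> topspace (Euclidean_space d)" and 0: "0 \<notin> convex hull Z"
  shows "\<exists>\<nu>\<in>topspace (Euclidean_space d). dotp d \<nu> \<nu> = 1 \<and> (\<forall>x\<in>Z. 0 \<le> dotp d \<nu> x)"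
proof -
  let ?E = "topspace (Euclidean_space d)" and ?C = "convex hull (emb d ` Z)"
  have "convex ?E"
    by (auto simp: convex_def topspace_Euclidean_space)
  then have hull_E: "convex hull Z \<subseteq> ?E"
    using Z(3) by (simp add: hull_minimal)
  have C: "?C = emb d ` (convex hull Z)"
    by (simp add: convex_hull_linear_image linear_emb)
  have "compact ?C"
    using Z(1) by (simp add: finite_imp_compact_convex_hull)
  then have "\<exists>p\<in>?C. \<forall>y\<in>?C. dist 0 p \<le> dist 0 y"
    using Z(2) by (intro continuous_attains_inf continuous_intros) auto
  then obtain p where p: "p \<in> ?C" "\<forall>y\<in>?C. dist 0 p \<le> dist 0 y" by blast
  then obtain w where w: "w \<in> convex hull Z" "p = emb d w" using C by auto
  have wE: "w \<in> ?E" using w hull_E by blast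
  have "w \<noteq> 0" using w 0 by auto
  then obtain k where "w k \<noteq> 0" by (auto simp: fun_eq_iff)
  then have pos: "dotp d w w > 0"
    using wE by (intro dotp_pos[of k]) (auto simp: topspace_Euclidean_space intro: leI)
  have ge: "0 \<le> dotp d w x" if "x \<in> Z" for x
  proof -
    have "emb d x \<in> ?C" using that by (intro hull_inc) auto
    then have "inner (0 - p) (emb d x - p) \<le> 0"
      using p \<open>compact ?C\<close> by (intro any_closest_point_dot[of ?C]) (auto intro: compact_imp_closed)
    then have "inner p p \<le> inner p (emb d x)" by (simp add: inner_diff_right)
    then show ?thesis
      using pos that Z(3) wE by (simp add: w(2) inner_emb proj_emb subset_iff)
  qed
  let ?s = "1 / sqrt (dotp d w w)"
  have scale: "dotp d (?s *\<^sub>R w) x = ?s * dotp d w x" for x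
    using linear_scale[OF linear_dotp[of d x], of ?s w] by (simp add: dotp_commute)
  show ?thesis
  proof (intro bexI conjI ballI)
    show "?s *\<^sub>R w \<in> ?E" using wE by (simp add: topspace_Euclidean_space)
    show "dotp d (?s *\<^sub>R w) (?s *\<^sub>R w) = 1"
      using pos by (simp add: scale linear_scale[OF linear_dotp] field_simps)
    show "0 \<le> dotp d (?s *\<^sub>R w) x" if "x \<in> Z" for x
      using ge[OF that] pos by (simp add: scale)
  qed
qed

text \<open>
  By the previous lemma finitely many of the conditions \<open>0 \<le> dotp d \<nu> x\<close> can be satisfied on the unit sphere
  simultaneously; each of them is closed in \<open>\<nu>\<close> and the sphere is compact, so all can.
\<close>

lemma supporting_normal:
  assumes D: "convex D" "D \<noteq> {}" "D \<subseteq> topspace (Euclidean_space d)" "0 \<notin> D"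
  shows "\<exists>\<nu>\<in>topspace (Euclidean_space d). dotp d \<nu> \<nu> = 1 \<and> (\<forall>x\<in>D. 0 \<le> dotp d \<nu> x)"
proof -
  let ?T = "{\<nu> \<in> topspace (Euclidean_space d). dotp d \<nu> \<nu> = 1}"
  obtain z0 where "z0 \<in> D" using D(2) by auto
  have "?T \<inter> (\<Inter>x\<in>D. {\<nu>. 0 \<le> dotp d \<nu> x}) \<noteq> {}"
  proof (rule compact_imp_fip_image[OF compact_Euclidean_sphere])
    show "closed {\<nu>. 0 \<le> dotp d \<nu> x}" for x
      by (intro closed_Collect_le continuous_on_dotp continuous_on_const)
    fix Z assume Z: "finite Z" "Z \<subseteq> D"
    have "convex hull (insert z0 Z) \<subseteq> D"
      using Z \<open>z0 \<in> D\<close> D(1) by (intro hull_minimal) auto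
    then have "\<exists>\<nu>\<in>topspace (Euclidean_space d). dotp d \<nu> \<nu> = 1 \<and> (\<forall>x\<in>insert z0 Z. 0 \<le> dotp d \<nu> x)"
      using Z D(3,4) \<open>z0 \<in> D\<close> by (intro finite_half_space_normal) auto
    then show "?T \<inter> (\<Inter>x\<in>Z. {\<nu>. 0 \<le> dotp d \<nu> x}) \<noteq> {}" by auto
  qed
  then show ?thesis by auto
qed

lemma separating_hyperplane_Euclidean_space:
  assumes A: "convex A" "A \<noteq> {}" "A \<subseteq> topspace (Euclidean_space d)"
    and B: "convex B" "B \<noteq> {}" "B \<subseteq> topspace (Euclidean_space d)" and disj: "A \<inter> B = {}"
  obtains \<nu> b where "\<nu> \<in> topspace (Euclidean_space d)" "dotp d \<nu> \<nu> = 1"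
    "\<And>x. x \<in> A \<Longrightarrow> dotp d \<nu> x \<le> b" "\<And>x. x \<in> B \<Longrightarrow> b \<le> dotp d \<nu> x"
proof -
  let ?D = "\<Union>y\<in>B. \<Union>x\<in>A. {y - x}"
  have "\<exists>\<nu>\<in>topspace (Euclidean_space d). dotp d \<nu> \<nu> = 1 \<and> (\<forall>x\<in>?D. 0 \<le> dotp d \<nu> x)"
  proof (rule supporting_normal)
    show "convex ?D" using A(1) B(1) by (intro convex_differences)
    show "?D \<noteq> {}" using A(2) B(2) by auto
    show "?D \<subseteq> topspace (Euclidean_space d)"
      using A(3) B(3) by (auto simp: topspace_Euclidean_space subset_iff)
    show "0 \<notin> ?D" using disj by auto
  qed
  then obtain \<nu> where \<nu>: "\<nu> \<in> topspace (Euclidean_space d)" "dotp d \<nu> \<nu> = 1"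
    and sep: "\<And>x y. x \<in> A \<Longrightarrow> y \<in> B \<Longrightarrow> 0 \<le> dotp d \<nu> (y - x)" by blast
  have le: "dotp d \<nu> x \<le> dotp d \<nu> y" if "x \<in> A" "y \<in> B" for x y
    using sep[OF that] by (simp add: linear_diff[OF linear_dotp])
  obtain y0 where "y0 \<in> B" using B(2) by auto
  show ?thesis
  proof (rule that[OF \<nu>, of "Sup (dotp d \<nu> ` A)"])
    show "dotp d \<nu> x \<le> Sup (dotp d \<nu> ` A)" if "x \<in> A" for x
      using that le \<open>y0 \<in> B\<close> by (intro cSup_upper bdd_aboveI2[where M = "dotp d \<nu> y0"]) auto
    show "Sup (dotp d \<nu> ` A) \<le> dotp d \<nu> y" if "y \<in> B" for y
      using that le A(2) by (intro cSup_least) auto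
  qed
qed

section \<open>Half-space and hyperplane sections\<close>

lemma dotp_fun_upd:
  assumes "k < d"
  shows "dotp d \<nu> (x(k := c)) = dotp d \<nu> x + \<nu> k * (c - x k)"
proof -
  have "dotp d \<nu> (x(k := c)) = \<nu> k * c + (\<Sum>i\<in>{..<d} - {k}. \<nu> i * x i)"
    unfolding dotp_def using assms by (subst sum.remove[of _ k]) (auto intro!: sum.cong)
  moreover have "dotp d \<nu> x = \<nu> k * x k + (\<Sum>i\<in>{..<d} - {k}. \<nu> i * x i)"
    unfolding dotp_def using assms by (subst sum.remove[of _ k]) auto
  ultimately show ?thesis by (simp add: algebra_simps)
qed

text \<open>
  The chart leaves out a coordinate \<open>k\<close> in which the normal does not vanish: it shifts the coordinates
  from \<open>k\<close> on by one and solves the equation of the hyperplane for coordinate \<open>k\<close>.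
\<close>

lemma hyperplane_chart:
  assumes k: "k < d" "\<nu> k \<noteq> 0"
  shows "\<exists>\<phi>. continuous_map (Euclidean_space (d - 1)) (Euclidean_space d) \<phi> \<and>
    (\<forall>u v x y. u + v = 1 \<longrightarrow> \<phi> (u *\<^sub>R x + v *\<^sub>R y) = u *\<^sub>R \<phi> x + v *\<^sub>R \<phi> y) \<and>
    \<phi> ` topspace (Euclidean_space (d - 1)) = {x \<in> topspace (Euclidean_space d). dotp d \<nu> x = b}"
proof -
  define skip :: "(nat \<Rightarrow> real) \<Rightarrow> nat \<Rightarrow> real"
    where "skip y = (\<lambda>i. if i < k then y i else if i = k then 0 else y (i - 1))" for y
  define h where "h y = (b - dotp d \<nu> (skip y)) / \<nu> k" for y
  define \<phi> where "\<phi> y = (\<lambda>i. if i < d then ((skip y)(k := h y)) i else 0)" for y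
  have dotp_\<phi>: "dotp d \<nu> (\<phi> y) = b" for y
  proof -
    have "dotp d \<nu> (\<phi> y) = dotp d \<nu> ((skip y)(k := h y))"
      by (simp add: dotp_def \<phi>_def)
    also have "\<dots> = b"
      using k by (simp add: dotp_fun_upd) (simp add: skip_def h_def)
    finally show ?thesis .
  qed
  have skip_linear: "linear skip"
    by (rule linearI) (auto simp: skip_def fun_eq_iff)
  have h_affine: "h (u *\<^sub>R x + v *\<^sub>R y) = u * h x + v * h y" if "u + v = 1" for u v x y
  proof -
    have b: "b / \<nu> k = u * b / \<nu> k + v * b / \<nu> k"
      using that by (simp flip: add_divide_distrib distrib_right)
    show ?thesis
      unfolding h_def linear_add[OF skip_linear] linear_scale[OF skip_linear]
        linear_add[OF linear_dotp] linear_scale[OF linear_dotp]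
      by (simp add: diff_divide_distrib add_divide_distrib right_diff_distrib) (rule b)
  qed
  have 1: "continuous_map (Euclidean_space (d - 1)) (Euclidean_space d) \<phi>"
    unfolding \<phi>_def continuous_map_componentwise_Euclidean_space
  proof (intro allI impI)
    fix i assume "i < d"
    have coord: "continuous_on UNIV (\<lambda>y. skip y j)" for j
      unfolding skip_def by (cases "j < k"; cases "j = k") auto
    then have "continuous_on UNIV h"
      unfolding h_def dotp_def by (intro continuous_intros) (use k in auto)
    then have "continuous_on UNIV (\<lambda>y. ((skip y)(k := h y)) i)"
      using coord by (cases "i = k") auto
    then show "continuous_map (Euclidean_space (d - 1)) euclideanreal (\<lambda>y. ((skip y)(k := h y)) i)"
      unfolding continuous_map_Euclidean_space_iff by (rule continuous_on_subset) simp
  qed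
  have 2: "\<phi> (u *\<^sub>R x + v *\<^sub>R y) = u *\<^sub>R \<phi> x + v *\<^sub>R \<phi> y" if "u + v = 1" for u v x y
    using h_affine[OF that]
    by (auto simp: \<phi>_def fun_eq_iff linear_add[OF skip_linear] linear_scale[OF skip_linear])
  have 3: "x \<in> \<phi> ` topspace (Euclidean_space (d - 1))"
    if x: "x \<in> topspace (Euclidean_space d)" "dotp d \<nu> x = b" for x
  proof
    define y where "y = (\<lambda>i. if i < k then x i else x (Suc i))"
    show "y \<in> topspace (Euclidean_space (d - 1))"
      using x k by (auto simp: y_def topspace_Euclidean_space)
    have "skip y = x(k := 0)"
      by (auto simp: skip_def y_def fun_eq_iff)
    then have "h y = x k"
      using k x(2) by (simp add: h_def dotp_fun_upd)
    then show "x = \<phi> y"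
      using \<open>skip y = x(k := 0)\<close> x(1) by (auto simp: \<phi>_def fun_eq_iff topspace_Euclidean_space)
  qed
  have 4: "\<phi> y \<in> topspace (Euclidean_space d)" for y
    by (simp add: \<phi>_def topspace_Euclidean_space)
  show ?thesis
  proof (intro exI[of _ \<phi>] conjI allI impI)
    show "\<phi> ` topspace (Euclidean_space (d - 1)) = {x \<in> topspace (Euclidean_space d). dotp d \<nu> x = b}"
      using 3 4 dotp_\<phi> by auto
  qed (fact 1 2)+
qed

lemma convex_union_representableI:
  assumes "finite V" "\<And>i. i \<in> V \<Longrightarrow> openin (Euclidean_space d) (U i)" "\<And>i. i \<in> V \<Longrightarrow> convex (U i)"
    "convex (\<Union>i\<in>V. U i)"
  shows "convex_union_representable V d (cover_nerve V U)"
  using assms abstract_simplicial_complex_nerve[OF assms(1), of U] nerve_eq_cover_nerve[OF assms(4)]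
  unfolding convex_union_representable_def by metis

lemma convex_union_representable_hyperplane_section:
  assumes V: "finite V" and U: "\<And>i. i \<in> V \<Longrightarrow> openin (Euclidean_space d) (U i)" "\<And>i. i \<in> V \<Longrightarrow> convex (U i)"
    and P: "convex (\<Union>i\<in>V. U i)" and k: "k < d" "\<nu> k \<noteq> 0"
  shows "convex_union_representable V (d - 1) (cover_nerve V (\<lambda>i. U i \<inter> {x. dotp d \<nu> x = b}))"
proof -
  let ?E = "topspace (Euclidean_space (d - 1))"
  from hyperplane_chart[of k d \<nu> b, OF k] obtain \<phi> where
    "continuous_map (Euclidean_space (d - 1)) (Euclidean_space d) \<phi> \<and>
    (\<forall>u v x y. u + v = 1 \<longrightarrow> \<phi> (u *\<^sub>R x + v *\<^sub>R y) = u *\<^sub>R \<phi> x + v *\<^sub>R \<phi> y) \<and>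
    \<phi> ` ?E = {x \<in> topspace (Euclidean_space d). dotp d \<nu> x = b}"
    by (rule exE)
  then have \<phi>: "continuous_map (Euclidean_space (d - 1)) (Euclidean_space d) \<phi>"
    "\<And>u v x y. u + v = 1 \<Longrightarrow> \<phi> (u *\<^sub>R x + v *\<^sub>R y) = u *\<^sub>R \<phi> x + v *\<^sub>R \<phi> y"
    "\<phi> ` ?E = {x \<in> topspace (Euclidean_space d). dotp d \<nu> x = b}"
    by simp_all
  define W where "W i = {y \<in> ?E. \<phi> y \<in> U i}" for i
  have convex_E: "convex ?E" by (auto simp: convex_def topspace_Euclidean_space)
  have convex_pre: "convex {y \<in> ?E. \<phi> y \<in> C}" if "convex C" for C
    using that convex_E \<phi>(2) unfolding convex_def by simp
  have "(\<Union>i\<in>V. W i) = {y \<in> ?E. \<phi> y \<in> (\<Union>i\<in>V. U i)}" by (auto simp: W_def)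
  then have "convex (\<Union>i\<in>V. W i)" using convex_pre[OF P] by simp
  then have "convex_union_representable V (d - 1) (cover_nerve V W)"
    using V U openin_continuous_map_preimage[OF \<phi>(1)] convex_pre
    by (intro convex_union_representableI) (auto simp: W_def)
  moreover have "cover_nerve V W = cover_nerve V (\<lambda>i. U i \<inter> {x. dotp d \<nu> x = b})"
  proof -
    have "cover_region V W \<tau> \<noteq> {} \<longleftrightarrow> cover_region V U \<tau> \<inter> {x. dotp d \<nu> x = b} \<noteq> {}"
      if "\<tau> \<subseteq> V" for \<tau>
    proof -
      have "cover_region V W \<tau> = {y \<in> ?E. \<phi> y \<in> cover_region V U \<tau>}"
        by (auto simp: cover_region_def W_def)
      then have "cover_region V W \<tau> \<noteq> {} \<longleftrightarrow> cover_region V U \<tau> \<inter> \<phi> ` ?E \<noteq> {}"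
        by auto
      moreover have "cover_region V U \<tau> \<subseteq> topspace (Euclidean_space d)"
        using openin_cover_region[OF V U(1) that] by (simp add: openin_subset)
      then have "cover_region V U \<tau> \<inter> \<phi> ` ?E = cover_region V U \<tau> \<inter> {x. dotp d \<nu> x = b}"
        unfolding \<phi>(3) by auto
      ultimately show ?thesis by simp
    qed
    then show ?thesis
      by (auto simp: cover_nerve_def cover_region_Int)
  qed
  ultimately show ?thesis by simp
qed

lemma convex_dotp_halfspace: "convex {x. b < dotp d \<nu> x}"
  using convex_linear_vimage[OF linear_dotp, of "{b<..}" d \<nu>] by (simp add: vimage_def)

lemma openin_dotp_halfspace:
  assumes "openin (Euclidean_space d) U"
  shows "openin (Euclidean_space d) (U \<inter> {x. b < dotp d \<nu> x})"
proof -
  have "continuous_map (Euclidean_space d) euclideanreal (dotp d \<nu>)"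
    by (simp add: continuous_map_Euclidean_space_iff continuous_on_dotp)
  then have "openin (Euclidean_space d) {x \<in> topspace (Euclidean_space d). dotp d \<nu> x \<in> {b<..}}"
    by (rule openin_continuous_map_preimage) simp
  then have "openin (Euclidean_space d) (U \<inter> {x \<in> topspace (Euclidean_space d). dotp d \<nu> x \<in> {b<..}})"
    using assms by (rule openin_Int[rotated])
  moreover have "U \<inter> {x \<in> topspace (Euclidean_space d). dotp d \<nu> x \<in> {b<..}} = U \<inter> {x. b < dotp d \<nu> x}"
    using openin_subset[OF assms] by auto
  ultimately show ?thesis by simp
qed

lemma convex_union_representable_halfspace:
  assumes V: "finite V" and U: "\<And>i. i \<in> V \<Longrightarrow> openin (Euclidean_space d) (U i)" "\<And>i. i \<in> V \<Longrightarrow> convex (U i)"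
    and P: "convex (\<Union>i\<in>V. U i)"
  shows "convex_union_representable V d (cover_nerve V (\<lambda>i. U i \<inter> {x. b < dotp d \<nu> x}))"
proof (rule convex_union_representableI[OF V])
  have "(\<Union>i\<in>V. U i \<inter> {x. b < dotp d \<nu> x}) = (\<Union>i\<in>V. U i) \<inter> {x. b < dotp d \<nu> x}" by auto
  then show "convex (\<Union>i\<in>V. U i \<inter> {x. b < dotp d \<nu> x})"
    by (simp add: convex_Int P convex_dotp_halfspace)
qed (use U in \<open>auto intro: openin_dotp_halfspace convex_Int convex_dotp_halfspace\<close>)

text \<open>
  A region that meets the hyperplane is open, so moving along \<open>\<plusminus>\<nu>\<close> leads to points on
  both sides; conversely a region with points on both sides is convex and crosses the hyperplane.
\<close>

lemma cover_nerve_hyperplane_split: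
  fixes b :: real
  assumes V: "finite V" and U: "\<And>i. i \<in> V \<Longrightarrow> openin (Euclidean_space d) (U i)" "\<And>i. i \<in> V \<Longrightarrow> convex (U i)"
    and P: "convex (\<Union>i\<in>V. U i)" and \<nu>: "\<nu> \<in> topspace (Euclidean_space d)" "dotp d \<nu> \<nu> = 1"
  defines "N\<^sub>1 \<equiv> cover_nerve V (\<lambda>i. U i \<inter> {x. b < dotp d \<nu> x})"
    and "N\<^sub>2 \<equiv> cover_nerve V (\<lambda>i. U i \<inter> {x. dotp d \<nu> x < b})"
  shows "cover_nerve V U = N\<^sub>1 \<union> N\<^sub>2"
    and "N\<^sub>1 \<inter> N\<^sub>2 = cover_nerve V (\<lambda>i. U i \<inter> {x. dotp d \<nu> x = b})"
proof -
  have mem: "\<tau> \<in> cover_nerve V (\<lambda>i. U i \<inter> C) \<longleftrightarrow> \<tau> \<subseteq> V \<and> (\<exists>x\<in>cover_region V U \<tau>. x \<in> C)" for \<tau> C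
    by (auto simp: cover_nerve_def cover_region_Int)
  have memU: "\<tau> \<in> cover_nerve V U \<longleftrightarrow> \<tau> \<subseteq> V \<and> (\<exists>x. x \<in> cover_region V U \<tau>)" for \<tau>
    by (auto simp: cover_nerve_def)
  have push: "(\<exists>y\<in>cover_region V U \<tau>. b < dotp d \<nu> y) \<and> (\<exists>y\<in>cover_region V U \<tau>. dotp d \<nu> y < b)"
    if "\<tau> \<subseteq> V" "x \<in> cover_region V U \<tau>" "dotp d \<nu> x = b" for \<tau> x
  proof -
    have R: "openin (Euclidean_space d) (cover_region V U \<tau>)"
      using V U(1) that(1) by (rule openin_cover_region)
    have "- \<nu> \<in> topspace (Euclidean_space d)"
      using \<nu>(1) by (simp add: topspace_Euclidean_space)
    from openin_Euclidean_space_perturb[OF R that(2) this] openin_Euclidean_space_perturb[OF R that(2) \<nu>(1)]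
    obtain s t where st: "s > 0" "x + s *\<^sub>R - \<nu> \<in> cover_region V U \<tau>" "t > 0" "x + t *\<^sub>R \<nu> \<in> cover_region V U \<tau>"
      by blast
    have "dotp d \<nu> (x + t *\<^sub>R \<nu>) = b + t" "dotp d \<nu> (x + s *\<^sub>R - \<nu>) = b - s"
      using that(3) \<nu>(2) linear_neg[OF linear_dotp]
      by (simp_all add: linear_add[OF linear_dotp] linear_diff[OF linear_dotp] linear_scale[OF linear_dotp])
    then show ?thesis using st by (metis less_add_same_cancel1 diff_less_eq)
  qed
  have meet: "\<exists>z\<in>cover_region V U \<tau>. dotp d \<nu> z = b"
    if "\<tau> \<subseteq> V" "x \<in> cover_region V U \<tau>" "y \<in> cover_region V U \<tau>" "dotp d \<nu> x < b" "b < dotp d \<nu> y" for \<tau> x y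
  proof -
    have "convex (cover_region V U \<tau>)"
      using U(2) P that(1) by (rule convex_cover_region)
    then show ?thesis
      using that(2-5) by (intro segment_meets_hyperplane[of "dotp d \<nu>" _ x y] linear_dotp)
  qed
  show "cover_nerve V U = N\<^sub>1 \<union> N\<^sub>2"
  proof (rule set_eqI)
    fix \<tau>
    show "\<tau> \<in> cover_nerve V U \<longleftrightarrow> \<tau> \<in> N\<^sub>1 \<union> N\<^sub>2"
      using push[of \<tau>] unfolding Un_iff N\<^sub>1_def N\<^sub>2_def mem memU mem_Collect_eq by (meson linorder_neqE)
  qed
  show "N\<^sub>1 \<inter> N\<^sub>2 = cover_nerve V (\<lambda>i. U i \<inter> {x. dotp d \<nu> x = b})"
  proof (rule set_eqI)
    fix \<tau>
    show "\<tau> \<in> N\<^sub>1 \<inter> N\<^sub>2 \<longleftrightarrow> \<tau> \<in> cover_nerve V (\<lambda>i. U i \<inter> {x. dotp d \<nu> x = b})"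
      using push[of \<tau>] meet[of \<tau>] unfolding Int_iff N\<^sub>1_def N\<^sub>2_def mem mem_Collect_eq by meson
  qed
qed

section \<open>Splitting along a separating hyperplane\<close>

theorem theorem5p1:
  fixes n d :: nat and \<Delta> :: "nat set set" and \<tau>\<^sub>1 \<tau>\<^sub>2 :: "nat set"
  assumes "convex_union_representable {1..n} d \<Delta>"
    and "\<tau>\<^sub>1 \<in> \<Delta>" and "\<tau>\<^sub>2 \<in> \<Delta>" and "\<tau>\<^sub>1 \<union> \<tau>\<^sub>2 \<notin> \<Delta>"
  shows "\<exists>\<Delta>\<^sub>1 \<Delta>\<^sub>2.
    abstract_simplicial_complex {1..n} \<Delta>\<^sub>1 \<and> abstract_simplicial_complex {1..n} \<Delta>\<^sub>2 \<and>
    \<Delta>\<^sub>1 \<subseteq> deletion \<Delta> \<tau>\<^sub>1 \<and> \<Delta>\<^sub>2 \<subseteq> deletion \<Delta> \<tau>\<^sub>2 \<and>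
    \<Delta> = \<Delta>\<^sub>1 \<union> \<Delta>\<^sub>2 \<and>
    collapses_onto \<Delta> \<Delta>\<^sub>1 \<and> collapses_onto \<Delta> \<Delta>\<^sub>2 \<and>
    collapses_onto \<Delta>\<^sub>1 (\<Delta>\<^sub>1 \<inter> \<Delta>\<^sub>2) \<and> collapses_onto \<Delta>\<^sub>2 (\<Delta>\<^sub>1 \<inter> \<Delta>\<^sub>2) \<and>
    convex_union_representable {1..n} d \<Delta>\<^sub>1 \<and> convex_union_representable {1..n} d \<Delta>\<^sub>2 \<and>
    d \<ge> 1 \<and> convex_union_representable {1..n} (d - 1) (\<Delta>\<^sub>1 \<inter> \<Delta>\<^sub>2)"
proof -
  let ?V = "{1..n}"
  obtain U where U: "\<And>i. i \<in> ?V \<Longrightarrow> openin (Euclidean_space d) (U i)" "\<And>i. i \<in> ?V \<Longrightarrow> convex (U i)"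
    and P: "convex (\<Union>i\<in>?V. U i)" and \<Delta>: "\<Delta> = cover_nerve ?V U"
    using assms(1) nerve_eq_cover_nerve unfolding convex_union_representable_def by metis
  define A where "A \<tau> = cover_region ?V U \<tau>" for \<tau>
  have A: "convex (A \<tau>)" "A \<tau> \<noteq> {}" "A \<tau> \<subseteq> topspace (Euclidean_space d)" if "\<tau> \<in> \<Delta>" for \<tau>
  proof -
    have "\<tau> \<subseteq> ?V" using that by (simp add: \<Delta> cover_nerve_def)
    show "convex (A \<tau>)" unfolding A_def using U(2) P \<open>\<tau> \<subseteq> ?V\<close> by (rule convex_cover_region)
    show "A \<tau> \<noteq> {}" using that by (simp add: \<Delta> cover_nerve_def A_def)
    have "openin (Euclidean_space d) (A \<tau>)"
      unfolding A_def using finite_atLeastAtMost U(1) \<open>\<tau> \<subseteq> ?V\<close> by (rule openin_cover_region)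
    then show "A \<tau> \<subseteq> topspace (Euclidean_space d)" by (rule openin_subset)
  qed
  have "\<tau>\<^sub>1 \<union> \<tau>\<^sub>2 \<subseteq> ?V" using assms(2,3) by (simp add: \<Delta> cover_nerve_def)
  then have "A (\<tau>\<^sub>1 \<union> \<tau>\<^sub>2) = {}" using assms(4) by (simp add: \<Delta> cover_nerve_def A_def)
  then have "A \<tau>\<^sub>1 \<inter> A \<tau>\<^sub>2 = {}" by (auto simp: A_def cover_region_def)
  then obtain \<nu> b where \<nu>: "\<nu> \<in> topspace (Euclidean_space d)" "dotp d \<nu> \<nu> = 1"
    and sep: "\<And>x. x \<in> A \<tau>\<^sub>1 \<Longrightarrow> dotp d \<nu> x \<le> b" "\<And>x. x \<in> A \<tau>\<^sub>2 \<Longrightarrow> b \<le> dotp d \<nu> x"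
    using separating_hyperplane_Euclidean_space[OF A[OF assms(2)] A[OF assms(3)]] by metis
  have "\<exists>k<d. \<nu> k \<noteq> 0"
  proof (rule ccontr)
    assume "\<not> ?thesis"
    then have "dotp d \<nu> \<nu> = 0" by (simp add: dotp_def)
    then show False using \<nu>(2) by simp
  qed
  then obtain k where k: "k < d" "\<nu> k \<noteq> 0" by blast
  define \<Delta>\<^sub>1 where "\<Delta>\<^sub>1 = cover_nerve ?V (\<lambda>i. U i \<inter> {x. b < dotp d \<nu> x})"
  define \<Delta>\<^sub>2 where "\<Delta>\<^sub>2 = cover_nerve ?V (\<lambda>i. U i \<inter> {x. dotp d \<nu> x < b})"
  (* The second half-space is a superlevel set of the functional with normal - \<nu>. *)
  have flip: "{x. dotp d \<nu> x < b} = {x. - b < dotp d (- \<nu>) x}"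
    by (auto simp: dotp_uminus_left)
  have union: "\<Delta> = \<Delta>\<^sub>1 \<union> \<Delta>\<^sub>2"
    unfolding \<Delta> \<Delta>\<^sub>1_def \<Delta>\<^sub>2_def using finite_atLeastAtMost U P \<nu> by (rule cover_nerve_hyperplane_split(1))
  have inter: "\<Delta>\<^sub>1 \<inter> \<Delta>\<^sub>2 = cover_nerve ?V (\<lambda>i. U i \<inter> {x. dotp d \<nu> x = b})"
    unfolding \<Delta>\<^sub>1_def \<Delta>\<^sub>2_def using finite_atLeastAtMost U P \<nu> by (rule cover_nerve_hyperplane_split(2))
  have coll1: "collapses_onto \<Delta> \<Delta>\<^sub>1"
    unfolding \<Delta> \<Delta>\<^sub>1_def using finite_atLeastAtMost U P k by (rule cover_nerve_collapses_onto_halfspace)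
  have coll2: "collapses_onto \<Delta> \<Delta>\<^sub>2"
    unfolding \<Delta> \<Delta>\<^sub>2_def flip using k by (intro cover_nerve_collapses_onto_halfspace[where k = k] U P) auto
  have rep1: "convex_union_representable ?V d \<Delta>\<^sub>1"
    unfolding \<Delta>\<^sub>1_def using finite_atLeastAtMost U P by (rule convex_union_representable_halfspace)
  have rep2: "convex_union_representable ?V d \<Delta>\<^sub>2"
    unfolding \<Delta>\<^sub>2_def flip using finite_atLeastAtMost U P by (rule convex_union_representable_halfspace)
  have rep12: "convex_union_representable ?V (d - 1) (\<Delta>\<^sub>1 \<inter> \<Delta>\<^sub>2)"
    unfolding inter using finite_atLeastAtMost U P k by (rule convex_union_representable_hyperplane_section)
  have del1: "\<Delta>\<^sub>1 \<subseteq> deletion \<Delta> \<tau>\<^sub>1"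
  proof
    fix \<sigma> assume "\<sigma> \<in> \<Delta>\<^sub>1"
    then obtain x where x: "x \<in> A \<sigma>" "b < dotp d \<nu> x"
      by (auto simp: \<Delta>\<^sub>1_def cover_nerve_def cover_region_Int A_def)
    then have "\<not> \<tau>\<^sub>1 \<subseteq> \<sigma>"
      using sep(1)[of x] cover_region_antimono[of \<tau>\<^sub>1 \<sigma> ?V U] by (auto simp: A_def)
    then show "\<sigma> \<in> deletion \<Delta> \<tau>\<^sub>1"
      using \<open>\<sigma> \<in> \<Delta>\<^sub>1\<close> union by (simp add: deletion_def)
  qed
  have del2: "\<Delta>\<^sub>2 \<subseteq> deletion \<Delta> \<tau>\<^sub>2"
  proof
    fix \<sigma> assume "\<sigma> \<in> \<Delta>\<^sub>2"
    then obtain x where x: "x \<in> A \<sigma>" "dotp d \<nu> x < b"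
      by (auto simp: \<Delta>\<^sub>2_def cover_nerve_def cover_region_Int A_def)
    then have "\<not> \<tau>\<^sub>2 \<subseteq> \<sigma>"
      using sep(2)[of x] cover_region_antimono[of \<tau>\<^sub>2 \<sigma> ?V U] by (auto simp: A_def)
    then show "\<sigma> \<in> deletion \<Delta> \<tau>\<^sub>2"
      using \<open>\<sigma> \<in> \<Delta>\<^sub>2\<close> union by (simp add: deletion_def)
  qed
  have "collapses_onto \<Delta>\<^sub>2 (\<Delta>\<^sub>2 \<inter> \<Delta>\<^sub>1)"
    using coll1 by (rule collapses_onto_restrict) (auto simp: union)
  then have coll2': "collapses_onto \<Delta>\<^sub>2 (\<Delta>\<^sub>1 \<inter> \<Delta>\<^sub>2)"
    by (simp only: Int_commute)
  have coll1': "collapses_onto \<Delta>\<^sub>1 (\<Delta>\<^sub>1 \<inter> \<Delta>\<^sub>2)"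
    using coll2 by (rule collapses_onto_restrict) (auto simp: union)
  have asc: "abstract_simplicial_complex ?V \<Delta>\<^sub>1" "abstract_simplicial_complex ?V \<Delta>\<^sub>2"
    using rep1 rep2 by (simp_all only: convex_union_representable_def)
  have "d \<ge> 1" using k(1) by simp
  with asc del1 del2 union coll1 coll2 coll1' coll2' rep1 rep2 rep12 show ?thesis
    by (intro exI[of _ \<Delta>\<^sub>1] exI[of _ \<Delta>\<^sub>2] conjI)
qed

end
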